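(* Let $M$ be a matroid and let $0<q<\infty$. Then $\underline{\mathrm{Gr}}^{\mathrm w}_M(\mathbb{T}_q)$ is homeomorphic to the inverse limit of a finite diagram of topological spaces, each of which is homeomorphic to a disc with three points removed from the boundary or to a five-dimensional closed ball with a copy of the Petersen graph removed from its boundary.
   Context: A matroid $M$ of rank $d$ on $[n]$ is identified with the subset of $\Delta^d_n=\{\alpha\in\mathbb{Z}^n_{\ge0}:\sum\alpha_i=d\}$ consisting of indicator vectors of its bases. For $0<q<\infty$, a weak $\mathbb{T}_q$-representation of $M$ is a function $\rho\colon\Delta^d_n\to\mathbb{R}_{\ge0}$ with support exactly the bases of $M$ such that for all $\alpha\in\Delta^{d-2}_n$ and $i\le j\le k\le l$ (with $\alpha$ and $\alpha+e_i+e_j+e_k+e_l$ between the coordinatewise min and max of the basis vectors), the three numbers $a=\rho(\alpha+e_j+e_k)\rho(\alpha+e_i+e_l)$, $b=\rho(\alpha+e_i+e_k)\rho(\alpha+e_j+e_l)$, $c=\rho(\alpha+e_i+e_j)\rho(\alpha+e_k+e_l)$ satisfy each of $a^{1/q},b^{1/q},c^{1/q}$ is at most the sum of the other two. $\underline{\mathrm{Gr}}^{\mathrm w}_M(\mathbb{T}_q)$ is the set of these, regarded in $\mathbb{R}^{\mathcal{B}(M)}_{>0}$ with the Euclidean topology, modulo the action of $\mathbb{R}^n_{>0}$ by $(t.\rho)(\alpha)=\prod_it_i^{\alpha_i}\rho(\alpha)$, with the quotient topology. *)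

theory Defs
  imports "HOL-Analysis.Analysis" "HOL-Library.Function_Algebras"
begin

section \<open>Matroids and weak representations over the triangular hyperfields\<close>

locale matroid_by_bases =
  fixes n d :: nat and \<B> :: "nat set set"
  assumes bases_nonempty: "\<B> \<noteq> {}"
    and bases_subset: "B \<in> \<B> \<Longrightarrow> B \<subseteq> {1..n}"
    and bases_card: "B \<in> \<B> \<Longrightarrow> card B = d"
    and exchange: "\<lbrakk>B \<in> \<B>; C \<in> \<B>; x \<in> B - C\<rbrakk> \<Longrightarrow> \<exists>y \<in> C - B. insert y (B - {x}) \<in> \<B>"

text \<open>Elements of \<open>\<int>\<^sup>n\<close> with nonnegative entries are functions \<open>nat \<Rightarrow> nat\<close> that vanish outside
  \<open>{1..n}\<close>; addition and order on them are pointwise.\<close>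

definition Delta :: "nat \<Rightarrow> nat \<Rightarrow> (nat \<Rightarrow> nat) set" where
  "Delta n d = {\<alpha>. (\<forall>i. i \<notin> {1..n} \<longrightarrow> \<alpha> i = 0) \<and> (\<Sum>i\<in>{1..n}. \<alpha> i) = d}"

definition unit_vec :: "nat \<Rightarrow> nat \<Rightarrow> nat" where
  "unit_vec i = indicator {i}"

definition basis_vectors :: "nat set set \<Rightarrow> (nat \<Rightarrow> nat) set" where
  "basis_vectors \<B> = indicator ` \<B>"

definition lower_vec :: "(nat \<Rightarrow> nat) set \<Rightarrow> nat \<Rightarrow> nat" where
  "lower_vec M i = Min ((\<lambda>\<beta>. \<beta> i) ` M)"

definition upper_vec :: "(nat \<Rightarrow> nat) set \<Rightarrow> nat \<Rightarrow> nat" where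
  "upper_vec M i = Max ((\<lambda>\<beta>. \<beta> i) ` M)"

text \<open>The relation \<open>0 \<in> a \<boxplus> b \<boxplus> c\<close> of \<open>\<T>\<^sub>q\<close>.\<close>

definition Tq_null :: "real \<Rightarrow> real \<Rightarrow> real \<Rightarrow> real \<Rightarrow> bool" where
  "Tq_null q a b c \<longleftrightarrow>
     a powr (1/q) \<le> b powr (1/q) + c powr (1/q) \<and>
     b powr (1/q) \<le> a powr (1/q) + c powr (1/q) \<and>
     c powr (1/q) \<le> a powr (1/q) + b powr (1/q)"

text \<open>The guard \<open>2 \<le> d\<close> makes up for truncated subtraction: there are no conditions if \<open>d < 2\<close>.\<close>

definition weak_Tq_rep :: "nat \<Rightarrow> nat \<Rightarrow> nat set set \<Rightarrow> real \<Rightarrow> ((nat \<Rightarrow> nat) \<Rightarrow> real) \<Rightarrow> bool" where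
  "weak_Tq_rep n d \<B> q \<rho> \<longleftrightarrow>
     \<rho> \<in> Delta n d \<rightarrow>\<^sub>E {0..} \<and>
     {\<alpha> \<in> Delta n d. \<rho> \<alpha> \<noteq> 0} = basis_vectors \<B> \<and>
     (2 \<le> d \<longrightarrow>
       (\<forall>\<alpha> \<in> Delta n (d - 2). \<forall>i\<in>{1..n}. \<forall>j\<in>{1..n}. \<forall>k\<in>{1..n}. \<forall>l\<in>{1..n}.
          i \<le> j \<and> j \<le> k \<and> k \<le> l \<and>
          lower_vec (basis_vectors \<B>) \<le> \<alpha> \<and>
          \<alpha> + unit_vec i + unit_vec j + unit_vec k + unit_vec l \<le> upper_vec (basis_vectors \<B>) \<longrightarrow>
          Tq_null q
            (\<rho> (\<alpha> + unit_vec j + unit_vec k) * \<rho> (\<alpha> + unit_vec i + unit_vec l))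
            (\<rho> (\<alpha> + unit_vec i + unit_vec k) * \<rho> (\<alpha> + unit_vec j + unit_vec l))
            (\<rho> (\<alpha> + unit_vec i + unit_vec j) * \<rho> (\<alpha> + unit_vec k + unit_vec l))))"

definition weak_rep_space ::
    "nat \<Rightarrow> nat \<Rightarrow> nat set set \<Rightarrow> real \<Rightarrow> ((nat \<Rightarrow> nat) \<Rightarrow> real) topology" where
  "weak_rep_space n d \<B> q =
     subtopology (product_topology (\<lambda>_. top_of_set {0<..}) (basis_vectors \<B>))
       ((\<lambda>\<rho>. restrict \<rho> (basis_vectors \<B>)) ` {\<rho>. weak_Tq_rep n d \<B> q \<rho>})"

definition torus_act ::
    "nat \<Rightarrow> nat set set \<Rightarrow> (nat \<Rightarrow> real) \<Rightarrow> ((nat \<Rightarrow> nat) \<Rightarrow> real) \<Rightarrow> ((nat \<Rightarrow> nat) \<Rightarrow> real)" where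
  "torus_act n \<B> t \<rho> = (\<lambda>\<alpha>\<in>basis_vectors \<B>. (\<Prod>i\<in>{1..n}. t i ^ \<alpha> i) * \<rho> \<alpha>)"

definition torus_orbit ::
    "nat \<Rightarrow> nat set set \<Rightarrow> ((nat \<Rightarrow> nat) \<Rightarrow> real) \<Rightarrow> ((nat \<Rightarrow> nat) \<Rightarrow> real) set" where
  "torus_orbit n \<B> \<rho> = {torus_act n \<B> t \<rho> | t. \<forall>i\<in>{1..n}. 0 < t i}"

definition quotient_topology :: "'a topology \<Rightarrow> ('a \<Rightarrow> 'b) \<Rightarrow> 'b topology" where
  "quotient_topology X p =
     topology (\<lambda>U. U \<subseteq> p ` topspace X \<and> openin X {x \<in> topspace X. p x \<in> U})"

lemma openin_quotient_topology:
  "openin (quotient_topology X p) U \<longleftrightarrow>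
     U \<subseteq> p ` topspace X \<and> openin X {x \<in> topspace X. p x \<in> U}"
proof -
  have "istopology (\<lambda>U. U \<subseteq> p ` topspace X \<and> openin X {x \<in> topspace X. p x \<in> U})"
    unfolding istopology_def
  proof (intro conjI allI impI)
    fix S T
    assume S: "S \<subseteq> p ` topspace X \<and> openin X {x \<in> topspace X. p x \<in> S}"
      and T: "T \<subseteq> p ` topspace X \<and> openin X {x \<in> topspace X. p x \<in> T}"
    show "S \<inter> T \<subseteq> p ` topspace X" using S by blast
    have "{x \<in> topspace X. p x \<in> S \<inter> T} =
        {x \<in> topspace X. p x \<in> S} \<inter> {x \<in> topspace X. p x \<in> T}" by blast
    then show "openin X {x \<in> topspace X. p x \<in> S \<inter> T}"
      using openin_Int[OF conjunct2[OF S] conjunct2[OF T]] by (simp only:)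
  next
    fix K
    assume K: "\<forall>S\<in>K. S \<subseteq> p ` topspace X \<and> openin X {x \<in> topspace X. p x \<in> S}"
    show "\<Union> K \<subseteq> p ` topspace X" using K by blast
    have "{x \<in> topspace X. p x \<in> \<Union> K} = (\<Union>S\<in>K. {x \<in> topspace X. p x \<in> S})" by blast
    then show "openin X {x \<in> topspace X. p x \<in> \<Union> K}" using K by auto
  qed
  then show ?thesis
    by (simp add: quotient_topology_def)
qed

lemma topspace_quotient_topology: "topspace (quotient_topology X p) = p ` topspace X"
proof
  show "topspace (quotient_topology X p) \<subseteq> p ` topspace X"
    using openin_quotient_topology[of X p "topspace (quotient_topology X p)"] by simp
  have "{x \<in> topspace X. p x \<in> p ` topspace X} = topspace X" by blast
  then have "openin (quotient_topology X p) (p ` topspace X)"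
    by (simp add: openin_quotient_topology)
  then show "p ` topspace X \<subseteq> topspace (quotient_topology X p)"
    by (rule openin_subset)
qed

lemma quotient_map_quotient_topology: "quotient_map X (quotient_topology X p) p"
  by (auto simp: quotient_map_def topspace_quotient_topology openin_quotient_topology)

definition Gr_weak_Tq ::
    "nat \<Rightarrow> nat \<Rightarrow> nat set set \<Rightarrow> real \<Rightarrow> ((nat \<Rightarrow> nat) \<Rightarrow> real) set topology" where
  "Gr_weak_Tq n d \<B> q = quotient_topology (weak_rep_space n d \<B> q) (torus_orbit n \<B>)"

section \<open>Punctured disc and punctured ball\<close>

definition is_disc_minus_three_points :: "'a topology \<Rightarrow> bool" where
  "is_disc_minus_three_points X \<longleftrightarrow>
     (\<exists>P. P \<subseteq> sphere (0::real^2) 1 \<and> card P = 3 \<and>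
          X homeomorphic_space top_of_set (cball 0 1 - P))"

text \<open>Points of the realization are barycentric coordinates supported on a vertex or an edge.\<close>

definition graph_realization :: "'v set \<Rightarrow> 'v set set \<Rightarrow> ('v \<Rightarrow> real) topology" where
  "graph_realization V E =
     subtopology (product_topology (\<lambda>_. euclideanreal) V)
       {x \<in> V \<rightarrow>\<^sub>E {0..}. (\<Sum>v\<in>V. x v) = 1 \<and> {v \<in> V. x v \<noteq> 0} \<in> (\<lambda>v. {v}) ` V \<union> E}"

definition petersen_vertices :: "nat set set" where
  "petersen_vertices = {s. s \<subseteq> {1..5} \<and> card s = 2}"

definition petersen_edges :: "nat set set set" where
  "petersen_edges = {{s, t} | s t. s \<in> petersen_vertices \<and> t \<in> petersen_vertices \<and> s \<inter> t = {}}"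

definition is_ball_minus_petersen :: "'a topology \<Rightarrow> bool" where
  "is_ball_minus_petersen X \<longleftrightarrow>
     (\<exists>P. P \<subseteq> sphere (0::real^5) 1 \<and>
          top_of_set P homeomorphic_space graph_realization petersen_vertices petersen_edges \<and>
          X homeomorphic_space top_of_set (cball 0 1 - P))"

section \<open>Finite diagrams of topological spaces and their limits\<close>

locale finite_category =
  fixes Obj :: "'o set" and Arr :: "'a set"
    and src tgt :: "'a \<Rightarrow> 'o" and ident :: "'o \<Rightarrow> 'a" and comp :: "'a \<Rightarrow> 'a \<Rightarrow> 'a"
  assumes finite_Obj: "finite Obj"
    and finite_Arr: "finite Arr"
    and src_in: "a \<in> Arr \<Longrightarrow> src a \<in> Obj"
    and tgt_in: "a \<in> Arr \<Longrightarrow> tgt a \<in> Obj"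
    and ident_in: "i \<in> Obj \<Longrightarrow> ident i \<in> Arr \<and> src (ident i) = i \<and> tgt (ident i) = i"
    and comp_in: "\<lbrakk>a \<in> Arr; b \<in> Arr; tgt a = src b\<rbrakk> \<Longrightarrow>
      comp b a \<in> Arr \<and> src (comp b a) = src a \<and> tgt (comp b a) = tgt b"
    and comp_ident_right: "a \<in> Arr \<Longrightarrow> comp a (ident (src a)) = a"
    and comp_ident_left: "a \<in> Arr \<Longrightarrow> comp (ident (tgt a)) a = a"
    and comp_assoc: "\<lbrakk>a \<in> Arr; b \<in> Arr; c \<in> Arr; tgt a = src b; tgt b = src c\<rbrakk> \<Longrightarrow>
      comp c (comp b a) = comp (comp c b) a"

locale finite_top_diagram = finite_category Obj Arr src tgt ident comp
  for Obj :: "'o set" and Arr :: "'a set"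
    and src tgt :: "'a \<Rightarrow> 'o" and ident :: "'o \<Rightarrow> 'a" and comp :: "'a \<Rightarrow> 'a \<Rightarrow> 'a" +
  fixes X :: "'o \<Rightarrow> 'x topology" and f :: "'a \<Rightarrow> 'x \<Rightarrow> 'x"
  assumes map_continuous: "a \<in> Arr \<Longrightarrow> continuous_map (X (src a)) (X (tgt a)) (f a)"
    and map_ident: "\<lbrakk>i \<in> Obj; x \<in> topspace (X i)\<rbrakk> \<Longrightarrow> f (ident i) x = x"
    and map_comp: "\<lbrakk>a \<in> Arr; b \<in> Arr; tgt a = src b; x \<in> topspace (X (src a))\<rbrakk> \<Longrightarrow>
      f (comp b a) x = f b (f a x)"

definition diagram_limit ::
    "'o set \<Rightarrow> 'a set \<Rightarrow> ('a \<Rightarrow> 'o) \<Rightarrow> ('a \<Rightarrow> 'o) \<Rightarrow> ('o \<Rightarrow> 'x topology) \<Rightarrow> ('a \<Rightarrow> 'x \<Rightarrow> 'x) \<Rightarrow>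
      ('o \<Rightarrow> 'x) topology" where
  "diagram_limit Obj Arr src tgt X f =
     subtopology (product_topology X Obj) {x. \<forall>a\<in>Arr. f a (x (src a)) = x (tgt a)}"

end

theory Submission
  imports Defs
begin

text \<open>
  Every space of the diagram can be taken to be a square with three corners removed, a disc with
  three points removed from its boundary. In the coordinates \<open>y = ln \<rho> / 2q\<close> the torus acts by
  translations along a linear subspace, so the quotient is the slice of representations orthogonal
  to that subspace. This slice is cut out by finitely many closed conditions, each of which involves
  only \<open>tanh (\<lambda> \<cdot> y)\<close> and \<open>tanh (\<mu> \<cdot> y)\<close> for two integral linear forms with entries in \<open>{-2..2}\<close>.
  The diagram has a source for each pair \<open>(\<lambda>, \<mu>)\<close> of such forms, carrying a point \<open>(u, t)\<close>, and a target
  for each form. The arrows send \<open>(u, t)\<close> to \<open>u\<close>, \<open>t\<close> and \<open>(u + t) / (1 + u t)\<close> at the targets \<open>\<lambda>\<close>, \<open>\<mu>\<close>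
  and \<open>\<lambda> + \<mu>\<close>. By the addition theorem for \<open>tanh\<close> they force the values at the targets to be
  \<open>tanh (\<lambda> \<cdot> y)\<close> for a unique \<open>y\<close>. Removing the corners \<open>(1, -1)\<close> and \<open>(-1, 1)\<close> makes the third arrow
  continuous and, through the pairs \<open>(\<lambda>, -\<lambda>)\<close>, keeps the values away from \<open>1\<close> and \<open>-1\<close>.
\<close>

section \<open>Two-level diagrams, indexed by natural numbers\<close>

section \<open>Bipartite diagrams\<close>

text \<open>All arrows lead from a source to a target, so no two of them compose, and adding
  identities already gives a category. Objects and arrows are then renamed by natural numbers along
  enumerations; the identities add no condition to the limit.\<close>

lemma bipartite_diagram:
  fixes S :: "'s set" and T :: "'t set" and A :: "'a set"
    and src :: "'a \<Rightarrow> 's" and tgt :: "'a \<Rightarrow> 't"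
    and X :: "'s + 't \<Rightarrow> 'x topology" and f :: "'a \<Rightarrow> 'x \<Rightarrow> 'x"
  assumes fin: "finite S" "finite T" "finite A"
    and src: "\<And>a. a \<in> A \<Longrightarrow> src a \<in> S" and tgt: "\<And>a. a \<in> A \<Longrightarrow> tgt a \<in> T"
    and cont: "\<And>a. a \<in> A \<Longrightarrow> continuous_map (X (Inl (src a))) (X (Inr (tgt a))) (f a)"
  shows "\<exists>(Obj :: nat set) (Arr :: nat set) src' tgt' ident comp X' f'.
    finite_top_diagram Obj Arr src' tgt' ident comp X' f' \<and>
    (\<forall>i\<in>Obj. \<exists>s\<in>S <+> T. X' i = X s) \<and>
    subtopology (product_topology X (S <+> T))
      {x. \<forall>a\<in>A. f a (x (Inl (src a))) = x (Inr (tgt a))}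
      homeomorphic_space diagram_limit Obj Arr src' tgt' X' f'"
proof -
  define Ob where "Ob = S <+> T"
  \<comment> \<open>\<open>Inl\<close> marks the identity of an object, \<open>Inr\<close> a given
    arrow.\<close>
  define Ar where "Ar = Ob <+> A"
  define eo where "eo = to_nat_on Ob"
  define dob where "dob = from_nat_into Ob"
  define ea where "ea = to_nat_on Ar"
  define da where "da = from_nat_into Ar"
  have finOb: "finite Ob" and finAr: "finite Ar"
    using fin by (auto simp: Ob_def Ar_def)
  have dob [simp]: "dob (eo s) = s" if "s \<in> Ob" for s
    using that finOb by (simp add: dob_def eo_def countable_finite)
  have da [simp]: "da (ea a) = a" if "a \<in> Ar" for a
    using that finAr by (simp add: da_def ea_def countable_finite)
  have eo_eq: "eo s = eo s' \<longleftrightarrow> s = s'" if "s \<in> Ob" "s' \<in> Ob" for s s'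
    using that dob by metis
  have ObI [simp]: "Inl s \<in> Ob \<longleftrightarrow> s \<in> S" "Inr t \<in> Ob \<longleftrightarrow> t \<in> T" for s t
    by (auto simp: Ob_def)
  have ArI [simp]: "Inl s \<in> Ar \<longleftrightarrow> s \<in> Ob" "Inr a \<in> Ar \<longleftrightarrow> a \<in> A" for s a
    by (auto simp: Ar_def)
  define src' where "src' = (\<lambda>m. eo (case da m of Inl s \<Rightarrow> s | Inr a \<Rightarrow> Inl (src a)))"
  define tgt' where "tgt' = (\<lambda>m. eo (case da m of Inl s \<Rightarrow> s | Inr a \<Rightarrow> Inr (tgt a)))"
  define ident where "ident = (\<lambda>m. ea (Inl (dob m)))"
  \<comment> \<open>One of two composable arrows is an identity.\<close>
  define comp where "comp = (\<lambda>b a :: nat. case da b of Inl s \<Rightarrow> a | Inr a' \<Rightarrow> b)"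
  define X' where "X' = (\<lambda>m. X (dob m))"
  define f' where "f' = (\<lambda>m x. case da m of Inl s \<Rightarrow> x | Inr a \<Rightarrow> f a x)"
  note defs = src'_def tgt'_def ident_def comp_def X'_def f'_def
  have ArE: "(\<exists>s. s \<in> Ob \<and> m = ea (Inl s)) \<or> (\<exists>a. a \<in> A \<and> m = ea (Inr a))" if "m \<in> ea ` Ar" for m
    using that unfolding Ar_def by auto
  have diag: "finite_top_diagram (eo ` Ob) (ea ` Ar) src' tgt' ident comp X' f'"
  proof
    show "finite (eo ` Ob)" "finite (ea ` Ar)" using finOb finAr by auto
    fix a assume a: "a \<in> ea ` Ar"
    show "src' a \<in> eo ` Ob" "tgt' a \<in> eo ` Ob" "comp a (ident (src' a)) = a"
      "comp (ident (tgt' a)) a = a"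
      "continuous_map (X' (src' a)) (X' (tgt' a)) (f' a)"
      using ArE[OF a] src tgt cont by (auto simp: defs)
    fix b assume b: "b \<in> ea ` Ar" and ab: "tgt' a = src' b"
    show "comp b a \<in> ea ` Ar \<and> src' (comp b a) = src' a \<and> tgt' (comp b a) = tgt' b"
      using ArE[OF a] ArE[OF b] ab src tgt a b by (auto simp: defs eo_eq)
    show "f' (comp b a) x = f' b (f' a x)" for x
      using ArE[OF a] ArE[OF b] ab src tgt by (auto simp: defs eo_eq)
    fix c
    show "comp c (comp b a) = comp (comp c b) a"
      by (auto simp: defs split: sum.splits)
  next
    fix i assume "i \<in> eo ` Ob"
    then show "ident i \<in> ea ` Ar \<and> src' (ident i) = i \<and> tgt' (ident i) = i" "f' (ident i) x = x" for x
      by (auto simp: defs)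
  qed
  let ?P = "{x. \<forall>a\<in>A. f a (x (Inl (src a))) = x (Inr (tgt a))}"
  let ?Q = "{x. \<forall>a\<in>ea ` Ar. f' a (x (src' a)) = x (tgt' a)}"
  define F :: "('s + 't \<Rightarrow> 'x) \<Rightarrow> nat \<Rightarrow> 'x" where "F = (\<lambda>x. \<lambda>i\<in>eo ` Ob. x (dob i))"
  define G :: "(nat \<Rightarrow> 'x) \<Rightarrow> 's + 't \<Rightarrow> 'x" where "G = (\<lambda>x. \<lambda>s\<in>Ob. x (eo s))"
  have F: "F x (eo s) = x s" if "s \<in> Ob" for x s
    using that by (simp add: F_def)
  have "homeomorphic_maps (product_topology X Ob) (product_topology X' (eo ` Ob)) F G"
    unfolding homeomorphic_maps_def continuous_map_componentwise
    by (auto simp: F_def G_def X'_def extensional_def PiE_def fun_eq_iff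
        intro!: continuous_map_product_projection)
       (metis continuous_map_product_projection dob image_eqI)
  moreover have "F ` (topspace (product_topology X Ob) \<inter> ?P) \<subseteq> ?Q"
  proof (rule image_subsetI, rule CollectI, rule ballI, elim IntE CollectE)
    fix x m
    assume "x \<in> topspace (product_topology X Ob)" and eq: "\<forall>a\<in>A. f a (x (Inl (src a))) = x (Inr (tgt a))"
      and m: "m \<in> ea ` Ar"
    then show "f' m (F x (src' m)) = F x (tgt' m)"
      using ArE[OF m] src tgt by (auto simp: F defs)
  qed
  moreover have "G ` (topspace (product_topology X' (eo ` Ob)) \<inter> ?Q) \<subseteq> ?P"
  proof (rule image_subsetI, rule CollectI, rule ballI, elim IntE CollectE)
    fix x a
    assume "\<forall>a\<in>ea ` Ar. f' a (x (src' a)) = x (tgt' a)" and a: "a \<in> A"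
    then have "f' (ea (Inr a)) (x (src' (ea (Inr a)))) = x (tgt' (ea (Inr a)))" by auto
    then show "f a (G x (Inl (src a))) = G x (Inr (tgt a))"
      using a src tgt by (auto simp: G_def defs)
  qed
  ultimately have "subtopology (product_topology X Ob) ?P
      homeomorphic_space diagram_limit (eo ` Ob) (ea ` Ar) src' tgt' X' f'"
    unfolding diagram_limit_def
    by (intro homeomorphic_maps_imp_homeomorphic_space[OF homeomorphic_maps_subtopologies_alt])
  with diag show ?thesis
    unfolding Ob_def by (intro exI conjI) (auto simp: X'_def Ob_def[symmetric])
qed

section \<open>A model of the disc without three boundary points\<close>

section \<open>The square without three corners\<close>

text \<open>All spaces of the diagram share the type \<open>nat \<Rightarrow> real\<close>, so
  points of the plane are padded with zeros.\<close>

definition pt :: "real \<Rightarrow> real \<Rightarrow> nat \<Rightarrow> real" where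
  "pt u t = (\<lambda>n. if n = 0 then u else if n = 1 then t else 0)"

lemma pt_simps [simp]: "pt u t 0 = u" "pt u t (Suc 0) = t"
  by (auto simp: pt_def)

lemma pt_eq_iff [simp]: "pt u t = pt u' t' \<longleftrightarrow> u = u' \<and> t = t'"
  by (metis pt_simps)

text \<open>At \<open>(1, -1)\<close> and \<open>(-1, 1)\<close> the denominator of
  \<open>vel_add\<close> vanishes. Removing \<open>(1, 1)\<close> as well makes the number of
  missing points three; no point \<open>(tanh x, tanh y)\<close> or \<open>(c, 0)\<close> is lost by
  it.\<close>

definition notched :: "real \<Rightarrow> real \<Rightarrow> bool" where
  "notched u t \<longleftrightarrow> \<bar>u\<bar> \<le> 1 \<and> \<bar>t\<bar> \<le> 1 \<and> (u, t) \<notin> {(1, -1), (-1, 1), (1, 1)}"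

definition notched_square :: "(nat \<Rightarrow> real) set" where
  "notched_square = {pt u t | u t. notched u t}"

lemma pt_in_notched_square [simp]: "pt u t \<in> notched_square \<longleftrightarrow> notched u t"
  by (auto simp: notched_square_def)

lemma notched_squareE:
  assumes "z \<in> notched_square"
  obtains "notched (z 0) (z 1)" "z = pt (z 0) (z 1)"
  using assms by (auto simp: notched_square_def)

lemma continuous_on_pt:
  assumes "continuous_on S f" "continuous_on S g"
  shows "continuous_on S (\<lambda>x. pt (f x) (g x))"
proof (rule continuous_on_coordinatewise_then_product)
  fix i
  show "continuous_on S (\<lambda>x. pt (f x) (g x) i)"
    using assms by (cases "i = 0"; cases "i = 1") (simp_all add: pt_def)
qed

text \<open>A compact convex set with nonempty interior is homeomorphic to the ball, and the
  homeomorphism sends the corners to the sphere. It remains to write points of \<open>real^2\<close>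
  as values of \<open>pt\<close>.\<close>

lemma disc_notched_square: "is_disc_minus_three_points (top_of_set notched_square)"
proof -
  let ?S = "cbox (-1) 1 :: (real^2) set"
  define C :: "(real^2) set" where "C = {vector [1,-1], vector [-1,1], vector [1,1]}"
  have mem: "x \<in> ?S \<longleftrightarrow> \<bar>x$1\<bar> \<le> 1 \<and> \<bar>x$2\<bar> \<le> 1" for x
    by (auto simp: mem_box_cart forall_2)
  have memb: "x \<in> interior ?S \<longleftrightarrow> \<bar>x$1\<bar> < 1 \<and> \<bar>x$2\<bar> < 1" for x
    by (auto simp: interior_cbox mem_box_cart forall_2)
  have "(0::real^2) \<in> interior ?S" unfolding memb by simp
  then have "interior ?S \<noteq> {}" by blast
  then have "?S homeomorphic cball (0::real^2) 1"
    by (intro homeomorphic_convex_compact_cball) (auto simp: convex_box compact_cbox)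
  then obtain h g where hg: "homeomorphism ?S (cball (0::real^2) 1) h g"
    unfolding homeomorphic_def by blast
  note hgD = hg[unfolded homeomorphism_def]
  have CS: "C \<subseteq> ?S" "C \<inter> interior ?S = {}"
    unfolding C_def using mem memb by (auto simp: vector_2)
  \<comment> \<open>If a corner went to the open ball, invariance of domain would make the image of
    the ball under \<open>g\<close> an open subset of the square containing that corner, which is
    not an interior point.\<close>
  have sph: "h p \<in> sphere 0 1" if p: "p \<in> C" for p
  proof (rule ccontr)
    assume n: "h p \<notin> sphere 0 1"
    have pS: "p \<in> ?S" using p CS by blast
    then have "h p \<in> cball 0 1" using hgD by blast
    with n have hp: "h p \<in> ball 0 1" by auto
    have sub: "ball 0 1 \<subseteq> (cball 0 1 :: (real^2) set)" by auto
    have "continuous_on (ball 0 1) g" using hgD continuous_on_subset[OF _ sub] by blast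
    moreover have "inj_on g (ball 0 1)"
      using hgD by (intro inj_on_inverseI[of _ h]) auto
    ultimately have "open (g ` ball 0 1)"
      by (intro invariance_of_domain) auto
    moreover have "g ` ball 0 1 \<subseteq> ?S" using hgD sub by blast
    ultimately have "g ` ball 0 1 \<subseteq> interior ?S" by (rule interior_maximal[rotated])
    moreover have "p \<in> g ` ball 0 1" using hp pS hgD by (metis imageI)
    ultimately show False using CS p by blast
  qed
  have inj: "inj_on h ?S" using hgD by (metis inj_onI)
  have "card C = 3"
    unfolding C_def by (auto simp: vec_eq_iff forall_2 vector_2)
  then have card: "card (h ` C) = 3"
    using card_image[OF inj_on_subset[OF inj CS(1)]] by simp
  have img: "h ` (?S - C) = cball 0 1 - h ` C"
    using inj_on_image_set_diff[OF inj _ CS(1), of ?S] hgD by auto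
  have A: "(?S - C) homeomorphic (cball 0 1 - h ` C)"
    unfolding homeomorphic_def using homeomorphism_of_subsets[OF hg _ subset_refl img] by blast
  have "homeomorphism (?S - C) notched_square (\<lambda>x. pt (x$1) (x$2)) (\<lambda>z. vector [z 0, z 1])"
    unfolding homeomorphism_def
  proof (intro conjI)
    show "continuous_on (?S - C) (\<lambda>x. pt (x$1) (x$2))"
      by (intro continuous_on_pt continuous_intros)
    show "continuous_on notched_square (\<lambda>z. vector [z 0, z 1] :: real^2)"
    proof -
      have eq: "(vector [z 0, z 1] :: real^2) = (\<chi> i. if i = 1 then z 0 else z 1)" for z :: "nat \<Rightarrow> real"
        by (simp add: vec_eq_iff forall_2)
      show ?thesis
        unfolding eq
      proof (rule continuous_on_vec_lambda)
        fix i :: 2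
        show "continuous_on notched_square (\<lambda>z. if i = 1 then z 0 else z 1)"
          by (cases "i = 1") (auto intro: continuous_on_subset[OF continuous_on_product_coordinates])
      qed
    qed
    have n: "notched (x$1) (x$2)" if "x \<in> ?S - C" for x :: "real^2"
      using that mem[of x] unfolding C_def notched_def
      by (simp add: vec_eq_iff forall_2 vector_2)
    have m: "vector [u, t] \<in> ?S - C" if "notched u t" for u t
      using that unfolding C_def notched_def
      by (auto simp: mem vec_eq_iff forall_2 vector_2)
    show inv: "\<forall>x\<in>?S - C. vector [pt (x$1) (x$2) 0, pt (x$1) (x$2) 1] = x"
      by (auto simp: vec_eq_iff forall_2 vector_2)
    show inv2: "\<forall>z\<in>notched_square. pt ((vector [z 0, z 1] :: real^2) $ 1) ((vector [z 0, z 1] :: real^2) $ 2) = z"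
      by (auto simp: vector_2 notched_square_def)
    show "(\<lambda>x. pt (x$1) (x$2)) ` (?S - C) = notched_square"
    proof
      show "(\<lambda>x. pt (x$1) (x$2)) ` (?S - C) \<subseteq> notched_square" using n by auto
      show "notched_square \<subseteq> (\<lambda>x. pt (x$1) (x$2)) ` (?S - C)"
      proof
        fix z assume z: "z \<in> notched_square"
        then show "z \<in> (\<lambda>x. pt (x$1) (x$2)) ` (?S - C)"
          using inv2 m by (intro image_eqI[of _ _ "vector [z 0, z 1]"]) (auto elim!: notched_squareE)
      qed
    qed
    show "(\<lambda>z. vector [z 0, z 1]) ` notched_square = ?S - C"
    proof
      show "(\<lambda>z. vector [z 0, z 1]) ` notched_square \<subseteq> ?S - C" using m by (auto elim!: notched_squareE)
      show "?S - C \<subseteq> (\<lambda>z. vector [z 0, z 1]) ` notched_square"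
      proof
        fix x assume x: "x \<in> ?S - C"
        then show "x \<in> (\<lambda>z. vector [z 0, z 1]) ` notched_square"
          using inv n by (intro image_eqI[of _ _ "pt (x$1) (x$2)"]) auto
      qed
    qed
  qed
  then have "notched_square homeomorphic (cball 0 1 - h ` C)"
    using A homeomorphic_sym homeomorphic_trans unfolding homeomorphic_def by meson
  then obtain k l where kl: "homeomorphism notched_square (cball 0 1 - h ` C) k l"
    unfolding homeomorphic_def by blast
  then have "homeomorphic_maps (top_of_set notched_square) (top_of_set (cball 0 1 - h ` C)) k l"
    unfolding homeomorphic_maps_def homeomorphism_def by auto
  then show ?thesis
    unfolding is_disc_minus_three_points_def homeomorphic_space_def
    using sph card by (intro exI[of _ "h ` C"]) auto
qed

section \<open>Additive functions on a box of integral forms\<close>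

section \<open>Integral linear forms\<close>

text \<open>The three-term relations compare sums of two coordinates, and the difference of two such
  sums has entries in \<open>{-2..2}\<close>.\<close>

definition box2 :: "'i set \<Rightarrow> ('i \<Rightarrow> int) set" where
  "box2 I = {l. (\<forall>b\<in>I. \<bar>l b\<bar> \<le> 2) \<and> (\<forall>b. b \<notin> I \<longrightarrow> l b = 0)}"

definition basis_fun :: "'i \<Rightarrow> 'i \<Rightarrow> int" where
  "basis_fun b = (\<lambda>c. if c = b then 1 else 0)"

definition pairing :: "'i set \<Rightarrow> ('i \<Rightarrow> int) \<Rightarrow> ('i \<Rightarrow> real) \<Rightarrow> real" where
  "pairing I l x = (\<Sum>b\<in>I. of_int (l b) * x b)"

lemma finite_box2: "finite I \<Longrightarrow> finite (box2 I)"
proof -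
  assume "finite I"
  then have "finite {l. \<forall>b. (b \<in> I \<longrightarrow> l b \<in> {-2..2::int}) \<and> (b \<notin> I \<longrightarrow> l b = 0)}"
    by (intro finite_set_of_finite_funs) auto
  then show ?thesis
    by (rule finite_subset[rotated]) (auto simp: box2_def abs_le_iff)
qed

lemma zero_box2 [simp]: "0 \<in> box2 I"
  by (simp add: box2_def)

lemma basis_fun_box2 [simp]: "b \<in> I \<Longrightarrow> basis_fun b \<in> box2 I"
  by (auto simp: box2_def basis_fun_def)

lemma uminus_box2 [simp]: "l \<in> box2 I \<Longrightarrow> - l \<in> box2 I"
  by (auto simp: box2_def)

lemma pairing_add: "pairing I (l + m) x = pairing I l x + pairing I m x"
  by (simp add: pairing_def algebra_simps sum.distrib)

lemma pairing_diff: "pairing I (l - m) x = pairing I l x - pairing I m x"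
  by (simp add: pairing_def algebra_simps sum_subtractf)

lemma pairing_zero [simp]: "pairing I 0 x = 0"
  by (simp add: pairing_def)

lemma pairing_basis_fun: "finite I \<Longrightarrow> b \<in> I \<Longrightarrow> pairing I (basis_fun b) x = x b"
proof -
  assume *: "finite I" "b \<in> I"
  have "pairing I (basis_fun b) x = (\<Sum>c\<in>I. if c = b then x c else 0)"
    unfolding pairing_def basis_fun_def by (intro sum.cong) auto
  then show ?thesis using * by simp
qed

lemma continuous_map_pairing:
  "finite I \<Longrightarrow> continuous_map (powertop_real I) euclideanreal (pairing I l)"
  unfolding pairing_def by (intro continuous_intros) auto

text \<open>Additivity is known only for sums that stay in the box. This suffices: every form
  reaches 0 by unit steps that shrink one entry, and these never leave the box.\<close>

lemma additive_on_box2: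
  fixes y :: "('i \<Rightarrow> int) \<Rightarrow> real"
  assumes I: "finite I"
    and add: "\<And>l m. l \<in> box2 I \<Longrightarrow> m \<in> box2 I \<Longrightarrow> l + m \<in> box2 I \<Longrightarrow> y (l + m) = y l + y m"
  shows "l \<in> box2 I \<Longrightarrow> y l = pairing I l (\<lambda>b. y (basis_fun b))"
proof (induction "\<Sum>b\<in>I. nat \<bar>l b\<bar>" arbitrary: l rule: less_induct)
  case less
  show ?case
  proof (cases "l = 0")
    case True
    then show ?thesis using add[of 0 0] by simp
  next
    case False
    then obtain b where b: "l b \<noteq> 0" by (auto simp: fun_eq_iff)
    with less.prems have bI: "b \<in> I" by (auto simp: box2_def)
    define s where "s = sgn (l b)"
    \<comment> \<open>\<open>m\<close> is one unit closer to 0 than \<open>l\<close> in the entry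
      \<open>b\<close>.\<close>
    define m where "m = l(b := l b - s)"
    have mem: "m \<in> box2 I"
      using less.prems bI b by (auto simp: box2_def m_def s_def sgn_if abs_le_iff)
    have "(\<Sum>c\<in>I. nat \<bar>m c\<bar>) < (\<Sum>c\<in>I. nat \<bar>l c\<bar>)"
      using bI b I by (intro sum_strict_mono_ex1) (auto simp: m_def s_def sgn_if)
    then have IH: "y m = pairing I m (\<lambda>b. y (basis_fun b))"
      using less.hyps mem by blast
    show ?thesis
    \<comment> \<open>For a negative entry the step is read backwards, as
      \<open>m = l + basis_fun b\<close>, so that \<open>- basis_fun b\<close> never enters.\<close>
    proof (cases "0 < l b")
      case True
      then have eq: "l = m + basis_fun b"
        by (auto simp: m_def s_def basis_fun_def fun_eq_iff)
      show ?thesis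
        unfolding eq using add[of m "basis_fun b"] mem bI less.prems IH eq
        by (simp only: pairing_add pairing_basis_fun[OF I bI] basis_fun_box2)
    next
      case False
      with b have eq: "m = l + basis_fun b"
        by (auto simp: m_def s_def basis_fun_def fun_eq_iff sgn_if)
      show ?thesis
        using add[of l "basis_fun b"] mem bI less.prems IH
        by (simp add: eq pairing_basis_fun[OF I bI] pairing_add)
    qed
  qed
qed

section \<open>Continuous functions on the notched square that serve as arrows\<close>

section \<open>Gates\<close>

text \<open>The addition law of \<open>tanh\<close>, known as relativistic addition of
  velocities.\<close>

definition vel_add :: "real \<Rightarrow> real \<Rightarrow> real" where
  "vel_add u t = (u + t) / (1 + u * t)"

text \<open>On the closed square \<open>u * t \<le> -1\<close> forces both absolute values to be 1
  with opposite signs, and these two corners are missing.\<close>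

lemma notched_denominator_pos:
  assumes "notched u t"
  shows "0 < 1 + u * t"
proof (rule ccontr)
  assume n: "\<not> 0 < 1 + u * t"
  have b: "\<bar>u\<bar> \<le> 1" "\<bar>t\<bar> \<le> 1" and c: "\<not> (u = 1 \<and> t = -1)" "\<not> (u = -1 \<and> t = 1)"
    using assms by (auto simp: notched_def)
  have "1 \<le> \<bar>u\<bar> * \<bar>t\<bar>" using n by (simp add: abs_mult[symmetric])
  moreover have "\<bar>u\<bar> * \<bar>t\<bar> \<le> \<bar>u\<bar>" "\<bar>u\<bar> * \<bar>t\<bar> \<le> \<bar>t\<bar>"
    using b by (auto simp: mult_left_le mult_left_le_one_le)
  ultimately have "\<bar>u\<bar> = 1" "\<bar>t\<bar> = 1" using b by auto
  then show False using n c by (auto simp: abs_if split: if_splits)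
qed

text \<open>Expanding \<open>(1 - u) * (1 - t) \<ge> 0\<close> and
  \<open>(1 + u) * (1 + t) \<ge> 0\<close> bounds the absolute value of the numerator by the
  denominator.\<close>

lemma abs_vel_add_le_1:
  assumes "notched u t"
  shows "\<bar>vel_add u t\<bar> \<le> 1"
proof -
  have "0 \<le> (1 - u) * (1 - t)" "0 \<le> (1 + u) * (1 + t)"
    using assms by (auto simp: notched_def abs_le_iff)
  then have "\<bar>u + t\<bar> \<le> 1 + u * t"
    by (simp add: abs_le_iff algebra_simps)
  then show ?thesis
    using notched_denominator_pos[OF assms] by (simp add: vel_add_def abs_divide)
qed

lemma tanh_add_real: "tanh (x + y) = vel_add (tanh x) (tanh y)" for x y :: real
  by (simp add: vel_add_def tanh_add cosh_real_nonzero)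

lemma tanh_artanh_real:
  fixes x :: real
  assumes "\<bar>x\<bar> < 1"
  shows "tanh (artanh x) = x"
proof -
  have x: "0 < 1 + x" "0 < 1 - x" using assms by auto
  have "exp (- 2 * artanh x) = inverse (exp (2 * artanh x))" by (simp add: exp_minus)
  also have "\<dots> = (1 - x) / (1 + x)" using x by (simp add: artanh_def exp_ln)
  finally show ?thesis using x unfolding tanh_real_altdef by (simp only:) (simp add: field_simps)
qed

lemma notched_tanh: "notched (tanh x) (tanh y)"
  using tanh_real_bounds[of x] tanh_real_bounds[of y] by (auto simp: notched_def)

text \<open>Gates 3 and 4 both end at the target of the zero form. Gate 4 makes the value there \<open>0\<close>, so gate 3
  imposes \<open>(u, t) \<in> C\<close>. The empty set is treated apart because \<open>infdist z {} = 0\<close>.\<close>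

definition gate :: "(real \<times> real) set \<Rightarrow> nat \<Rightarrow> real \<Rightarrow> real \<Rightarrow> real" where
  "gate C k u t =
     (if k = 0 then u else if k = 1 then t else if k = 2 then vel_add u t
      else if k = 3 then (if C = {} then 1 else min 1 (infdist (u, t) C)) else 0)"

text \<open>Keeps the value of an arrow, padded with second coordinate 0, in the notched square; for
  this the distance in gate 3 is cut off at 1.\<close>

lemma gate_bounded: "notched u t \<Longrightarrow> \<bar>gate C k u t\<bar> \<le> 1"
  using abs_vel_add_le_1[of u t] by (auto simp: gate_def notched_def infdist_nonneg)

lemma continuous_on_gate: "continuous_on notched_square (\<lambda>z. gate C k (z 0) (z 1))"
proof -
  have c: "continuous_on notched_square (\<lambda>z. z i)" for i
    by (rule continuous_on_subset[OF continuous_on_product_coordinates]) auto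
  have "1 + z 0 * z 1 \<noteq> 0" if "z \<in> notched_square" for z
    using that by (auto elim!: notched_squareE dest: notched_denominator_pos)
  then have "continuous_on notched_square (\<lambda>z. vel_add (z 0) (z 1))"
    unfolding vel_add_def by (intro continuous_intros c) auto
  moreover have "continuous_on notched_square (\<lambda>z. min 1 (infdist (z 0, z 1) C))"
    by (intro continuous_intros c)
  ultimately show ?thesis
    unfolding gate_def using c by (cases "k = 0"; cases "k = 1"; cases "k = 2"; cases "k = 3"; cases "C = {}"; simp)
qed

text \<open>A nonempty closed set is the zero set of its distance function; for empty
  \<open>C\<close> the gate is constantly 1.\<close>

lemma gate_3_eq_0: "closed C \<Longrightarrow> gate C 3 u t = 0 \<longleftrightarrow> (u, t) \<in> C"
  by (auto simp: gate_def in_closed_iff_infdist_zero min_def)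

text \<open>The numerator vanishes only for \<open>t = - u\<close>, and both ends of this
  antidiagonal are missing corners.\<close>

lemma abs_lt_1_if_vel_add_eq_0:
  assumes "notched u t" "vel_add u t = 0"
  shows "\<bar>u\<bar> < 1"
  using assms notched_denominator_pos[OF assms(1)]
  by (auto simp: vel_add_def notched_def abs_if split: if_splits)

section \<open>Limits that encode closed relations between tangents\<close>

section \<open>Systems of relations between hyperbolic tangents as limits\<close>

text \<open>Each condition sees two forms at a time because a source of the diagram carries two
  coordinates; \<open>UNIV\<close> imposes nothing.\<close>

definition tanh_system :: "'i set \<Rightarrow> (('i \<Rightarrow> int) \<times> ('i \<Rightarrow> int) \<Rightarrow> (real \<times> real) set) \<Rightarrow> ('i \<Rightarrow> real) set" where
  "tanh_system I C =
     {x. \<forall>l\<in>box2 I. \<forall>m\<in>box2 I. (tanh (pairing I l x), tanh (pairing I m x)) \<in> C (l, m)}"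

text \<open>A point of the limit is determined by its target values. These are \<open>tanh\<close>
  of numbers additive in the form, hence come from one vector, which \<open>artanh\<close> recovers
  from the basis forms.\<close>

theorem tanh_system_is_limit:
  fixes I :: "'i set" and C :: "('i \<Rightarrow> int) \<times> ('i \<Rightarrow> int) \<Rightarrow> (real \<times> real) set"
  assumes I: "finite I" and C: "\<And>s. closed (C s)"
  shows "\<exists>(Obj :: nat set) (Arr :: nat set) src tgt ident comp X f.
    finite_top_diagram Obj Arr src tgt ident comp X f \<and>
    (\<forall>i\<in>Obj. X i = top_of_set notched_square) \<and>
    subtopology (powertop_real I) (tanh_system I C) homeomorphic_space diagram_limit Obj Arr src tgt X f"
proof -
  define T where "T = box2 I"
  define S where "S = T \<times> T"
  \<comment> \<open>The arrows out of a pair are the five gates; gate 2 is present only if its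
    target \<open>l + m\<close> lies in the box.\<close>
  define A where "A = {((l, m), k) | l m k. (l, m) \<in> S \<and> k < (5::nat) \<and> (k = 2 \<longrightarrow> l + m \<in> T)}"
  define tgt :: "(('i \<Rightarrow> int) \<times> ('i \<Rightarrow> int)) \<times> nat \<Rightarrow> 'i \<Rightarrow> int" where
    "tgt = (\<lambda>((l, m), k). if k = 0 then l else if k = 1 then m else if k = 2 then l + m else 0)"
  \<comment> \<open>A target carries one number, stored as a first coordinate next to a second
    coordinate 0.\<close>
  define f :: "(('i \<Rightarrow> int) \<times> ('i \<Rightarrow> int)) \<times> nat \<Rightarrow> (nat \<Rightarrow> real) \<Rightarrow> nat \<Rightarrow> real" where
    "f = (\<lambda>(s, k) z. pt (gate (C s) k (z 0) (z 1)) 0)"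
  define N where "N = top_of_set notched_square"
  define X where "X = (\<lambda>_ :: ('i \<Rightarrow> int) \<times> ('i \<Rightarrow> int) + ('i \<Rightarrow> int). N)"
  define L where "L = {y. \<forall>a\<in>A. f a (y (Inl (fst a))) = y (Inr (tgt a))}"
  have finT: "finite T" unfolding T_def by (rule finite_box2[OF I])
  have "A \<subseteq> S \<times> {..<5}" by (auto simp: A_def)
  then have finA: "finite A" using finT by (auto simp: S_def intro: finite_subset)
  have zT: "0 \<in> T" by (simp add: T_def)
  have contf: "continuous_map N N (f a)" for a
  proof -
    obtain s k where a: "a = (s, k)" by fastforce
    have "notched (gate (C s) k u t) 0" if "notched u t" for u t
      using gate_bounded[OF that, of "C s" k] by (auto simp: notched_def)
    then show ?thesis
      unfolding N_def f_def a
      using continuous_on_pt[OF continuous_on_gate[of "C s" k] continuous_on_const[of _ 0]]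
      by (auto elim!: notched_squareE)
  qed
  have srcS: "fst a \<in> S" and tgtT: "tgt a \<in> T" if "a \<in> A" for a
    using that zT by (auto simp: A_def S_def tgt_def)
  have finS: "finite S" using finT by (simp add: S_def)
  obtain Obj Arr :: "nat set" and src' tgt' ident comp X' f' where
      diag: "finite_top_diagram Obj Arr src' tgt' ident comp X' f'"
    and objs: "\<forall>i\<in>Obj. \<exists>s\<in>S <+> T. X' i = X s"
    and lim: "subtopology (product_topology X (S <+> T)) L
      homeomorphic_space diagram_limit Obj Arr src' tgt' X' f'"
    using bipartite_diagram[of S T A fst tgt X f, OF finS finT finA srcS tgtT] contf
    unfolding L_def X_def by blast
  define F :: "('i \<Rightarrow> real) \<Rightarrow> ('i \<Rightarrow> int) \<times> ('i \<Rightarrow> int) + ('i \<Rightarrow> int) \<Rightarrow> nat \<Rightarrow> real" where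
    "F = (\<lambda>x. \<lambda>r\<in>S <+> T. case r of
        Inl (l, m) \<Rightarrow> pt (tanh (pairing I l x)) (tanh (pairing I m x))
      | Inr l \<Rightarrow> pt (tanh (pairing I l x)) 0)"
  define G :: "(('i \<Rightarrow> int) \<times> ('i \<Rightarrow> int) + ('i \<Rightarrow> int) \<Rightarrow> nat \<Rightarrow> real) \<Rightarrow> 'i \<Rightarrow> real" where
    "G = (\<lambda>y. \<lambda>b\<in>I. artanh (y (Inr (basis_fun b)) 0))"
  have bT: "basis_fun b \<in> T" if "b \<in> I" for b using that by (simp add: T_def)

  let ?P = "product_topology X (S <+> T)"
  \<comment> \<open>What membership in the limit forces on the values of \<open>y\<close>, proved
    together since all five facts rest on the same gate equations.\<close>
  have lt1: "\<bar>y (Inr l) 0\<bar> < 1"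
    and yS: "m \<in> T \<Longrightarrow> y (Inl (l, m)) = pt (y (Inr l) 0) (y (Inr m) 0)"
    and yT: "y (Inr l) = pt (y (Inr l) 0) 0"
    and ytanh: "y (Inr l) 0 = tanh (pairing I l (G y))"
    and yC: "m \<in> T \<Longrightarrow> (y (Inr l) 0, y (Inr m) 0) \<in> C (l, m)"
    if y: "y \<in> topspace ?P" "y \<in> L" and l: "l \<in> T" for y l m
  proof -
    have mem: "y r \<in> notched_square" if "r \<in> S <+> T" for r
      using y(1) that by (auto simp: X_def N_def)
    have arr: "pt (gate (C s) k (y (Inl s) 0) (y (Inl s) 1)) 0 = y (Inr (tgt (s, k)))"
      if "(s, k) \<in> A" for s k
      using y(2) that by (auto simp: L_def f_def)
    \<comment> \<open>Gate 4 at the pair \<open>(0, 0)\<close> pins the value at the zero form to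
      0.\<close>
    have y0: "y (Inr 0) = pt 0 0"
      using arr[of "(0,0)" 4] zT by (auto simp: A_def S_def tgt_def gate_def)
    \<comment> \<open>Gates 0 and 1 identify the coordinates at a source with the values at its two
      targets.\<close>
    have T: "y (Inr l) = pt (y (Inl (l, m)) 0) 0" "y (Inr m) = pt (y (Inl (l, m)) 1) 0"
      if "l \<in> T" "m \<in> T" for l m
      using arr[of "(l,m)" 0] arr[of "(l,m)" 1] that by (auto simp: A_def S_def tgt_def gate_def)
    show "y (Inr l) = pt (y (Inr l) 0) 0"
      using T(1)[OF l l] by simp
    have S': "y (Inl (l, m)) = pt (y (Inr l) 0) (y (Inr m) 0)" if "l \<in> T" "m \<in> T" for l m
    proof -
      have "y (Inl (l, m)) \<in> notched_square" using mem that by (auto simp: S_def)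
      then have "y (Inl (l, m)) = pt (y (Inl (l, m)) 0) (y (Inl (l, m)) 1)"
        by (auto elim: notched_squareE)
      then show ?thesis using T[OF that] by simp
    qed
    show "m \<in> T \<Longrightarrow> y (Inl (l, m)) = pt (y (Inr l) 0) (y (Inr m) 0)"
      using S' l by simp
    have nt: "notched (y (Inr l) 0) (y (Inr m) 0)" if "l \<in> T" "m \<in> T" for l m
      using mem[of "Inl (l, m)"] that S'[OF that] by (auto simp: S_def)
    have add: "y (Inr (l + m)) 0 = vel_add (y (Inr l) 0) (y (Inr m) 0)"
      if "l \<in> T" "m \<in> T" "l + m \<in> T" for l m
      using arr[of "(l,m)" 2] that S'[of l m] pt_simps
      by (auto simp: A_def S_def tgt_def gate_def dest: fun_cong[of _ _ 0])
    \<comment> \<open>The source of \<open>(l, - l)\<close> has gate 2 equal to 0, and the ends of the antidiagonal are missing.\<close>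
    have lt: "\<bar>y (Inr l) 0\<bar> < 1" if "l \<in> T" for l
    proof -
      have m: "- l \<in> T" using that by (simp add: T_def)
      have "vel_add (y (Inr l) 0) (y (Inr (- l)) 0) = 0"
        using add[OF that m] zT y0 by simp
      then show ?thesis using abs_lt_1_if_vel_add_eq_0 nt[OF that m] by blast
    qed
    show "\<bar>y (Inr l) 0\<bar> < 1" using lt l by simp
    \<comment> \<open>\<open>artanh\<close> turns the law \<open>vel_add\<close> into ordinary
      addition, so that \<open>additive_on_box2\<close> applies.\<close>
    define a where "a = (\<lambda>l. artanh (y (Inr l) 0))"
    have tanh_a: "tanh (a l) = y (Inr l) 0" if "l \<in> T" for l
      using lt[OF that] by (simp add: a_def tanh_artanh_real)
    have "a (l + m) = a l + a m" if "l \<in> T" "m \<in> T" "l + m \<in> T" for l m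
    proof -
      have "tanh (a (l + m)) = tanh (a l + a m)"
        using that by (simp add: tanh_a tanh_add_real add)
      then show ?thesis by (metis artanh_tanh_real)
    qed
    then have "a l = pairing I l (\<lambda>b. a (basis_fun b))"
      using additive_on_box2[OF I, of a l] l by (simp add: T_def)
    also have "\<dots> = pairing I l (G y)"
      by (simp add: pairing_def G_def a_def)
    finally show "y (Inr l) 0 = tanh (pairing I l (G y))"
      using tanh_a[OF l] by simp
    show "(y (Inr l) 0, y (Inr m) 0) \<in> C (l, m)" if m: "m \<in> T"
    proof -
      have "gate (C (l, m)) 3 (y (Inr l) 0) (y (Inr m) 0) = 0"
        using arr[of "(l,m)" 3] l m y0 S'[OF l m] by (auto simp: A_def S_def tgt_def)
      then show ?thesis using gate_3_eq_0[OF C] by blast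
    qed
  qed

  have FL: "F x \<in> L" if x: "x \<in> tanh_system I C" for x
    unfolding L_def
  proof (rule CollectI, rule ballI)
    fix a assume a: "a \<in> A"
    then obtain l m k where eq: "a = ((l, m), k)" and lm: "l \<in> T" "m \<in> T" and k: "k < 5" "k = 2 \<longrightarrow> l + m \<in> T"
      by (auto simp: A_def S_def)
    have "gate (C (l, m)) 3 (tanh (pairing I l x)) (tanh (pairing I m x)) = 0"
      using x lm unfolding gate_3_eq_0[OF C] by (auto simp: tanh_system_def T_def)
    moreover have "k \<in> {0,1,2,3,4}" using k by auto
    \<comment> \<open>Gates 0, 1 and 4 match by definition, gate 2 by the addition theorem, gate 3
      by the first fact.\<close>
    ultimately show "f a (F x (Inl (fst a))) = F x (Inr (tgt a))"
      using lm k zT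
      by (auto simp: eq f_def F_def tgt_def S_def gate_def[of _ 0] gate_def[of _ "Suc 0"]
          gate_def[of _ 2] gate_def[of _ 4] pairing_add tanh_add_real)
  qed
  have GK: "G y \<in> tanh_system I C" if "y \<in> topspace ?P" "y \<in> L" for y
    unfolding tanh_system_def T_def[symmetric]
  proof (intro CollectI ballI)
    fix l m assume lm: "l \<in> T" "m \<in> T"
    show "(tanh (pairing I l (G y)), tanh (pairing I m (G y))) \<in> C (l, m)"
      using yC[OF that lm] ytanh[OF that lm(1)] ytanh[OF that lm(2)] by simp
  qed
  have GF: "G (F x) = x" if "x \<in> extensional I" for x
  proof
    fix b
    show "G (F x) b = x b"
      using that bT[of b]
      by (cases "b \<in> I")
        (simp_all add: G_def F_def InrI extensional_def pairing_basis_fun[OF I] artanh_tanh_real)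
  qed
  have FG: "F (G y) = y" if y: "y \<in> topspace ?P" "y \<in> L" for y
  proof
    fix r
    show "F (G y) r = y r"
    proof (cases "r \<in> S <+> T")
      case False
      then show ?thesis using y(1) by (auto simp: F_def PiE_def extensional_def)
    next
      case True
      then show ?thesis
      proof
        fix s assume r: "r = Inl s" and s: "s \<in> S"
        obtain l m where lm: "s = (l, m)" "l \<in> T" "m \<in> T" using s by (auto simp: S_def)
        then show ?thesis
          using True yS[OF y lm(2,3)] ytanh[OF y lm(2)] ytanh[OF y lm(3)] by (simp add: F_def r)
      next
        fix l assume r: "r = Inr l" and l: "l \<in> T"
        then show ?thesis using True yT[OF y l] ytanh[OF y l] by (simp add: F_def)
      qed
    qed
  qed
  have contF: "continuous_map (powertop_real I) ?P F"
    unfolding continuous_map_componentwise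
  proof (intro conjI ballI)
    show "F ` topspace (powertop_real I) \<subseteq> extensional (S <+> T)" by (auto simp: F_def)
    fix r assume r: "r \<in> S <+> T"
    have ct: "continuous_map (powertop_real I) euclideanreal (\<lambda>x. tanh (pairing I l x))" for l
      using continuous_map_compose[OF continuous_map_pairing[OF I, of l], of euclideanreal tanh]
      by (simp add: o_def continuous_on_tanh cosh_real_nonzero continuous_on_id)
    have cp: "continuous_map (powertop_real I) N (\<lambda>x. pt (u x) (t x))"
      if "continuous_map (powertop_real I) euclideanreal u" "continuous_map (powertop_real I) euclideanreal t"
        "\<And>x. notched (u x) (t x)" for u t
    proof -
      have "continuous_map (powertop_real I) euclidean (\<lambda>x. pt (u x) (t x))"
        unfolding euclidean_product_topology[symmetric] continuous_map_componentwise_UNIV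
      proof
        fix i show "continuous_map (powertop_real I) euclideanreal (\<lambda>x. pt (u x) (t x) i)"
          using that(1,2) by (cases "i = 0"; cases "i = 1") (simp_all add: pt_def)
      qed
      then show ?thesis using that(3) by (simp add: N_def continuous_map_in_subtopology image_subset_iff)
    qed
    show "continuous_map (powertop_real I) (X r) (\<lambda>x. F x r)"
      using r
    proof
      fix s assume rs: "r = Inl s" and s: "s \<in> S"
      obtain l m where "s = (l, m)" by fastforce
      then show ?thesis using r cp[OF ct ct notched_tanh, of l m] by (simp add: rs F_def X_def)
    next
      fix l assume "r = Inr l" "l \<in> T"
      then show ?thesis using r cp[OF ct, of "\<lambda>_. 0" l] notched_tanh[of _ 0]  by (simp add: F_def X_def)
    qed
  qed
  \<comment> \<open>\<open>artanh\<close> is continuous only inside \<open>(-1, 1)\<close>, and only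
    on \<open>L\<close> are the values known to lie there. Hence \<open>G\<close> is treated on the
    subspace, unlike \<open>F\<close>.\<close>
  have contG: "continuous_map (subtopology ?P L) (powertop_real I) G"
    unfolding continuous_map_componentwise
  proof (intro conjI ballI)
    show "G ` topspace (subtopology ?P L) \<subseteq> extensional I" by (auto simp: G_def)
    fix b assume b: "b \<in> I"
    have c1: "continuous_map (subtopology ?P L) N (\<lambda>y. y (Inr (basis_fun b)))"
      using continuous_map_from_subtopology[OF continuous_map_product_projection[of "Inr (basis_fun b)" "S <+> T" X], of L]
        InrI[OF bT[OF b], of S] by (simp add: X_def)
    have "continuous_map N euclideanreal (\<lambda>z. z 0)"
      unfolding N_def by (simp add: continuous_on_subset[OF continuous_on_product_coordinates])
    from continuous_map_compose[OF c1 this]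
    have "continuous_map (subtopology ?P L) euclideanreal (\<lambda>y. y (Inr (basis_fun b)) 0)"
      by (simp add: o_def)
    then have c2: "continuous_map (subtopology ?P L) (top_of_set {-1<..<1}) (\<lambda>y. y (Inr (basis_fun b)) 0)"
      using lt1 bT[OF b] by (fastforce simp: continuous_map_in_subtopology image_subset_iff abs_less_iff)
    have "continuous_map (top_of_set {-1<..<1}) euclideanreal (artanh :: real \<Rightarrow> real)"
      by (simp add: continuous_on_artanh)
    from continuous_map_compose[OF c2 this]
    show "continuous_map (subtopology ?P L) euclideanreal (\<lambda>y. G y b)"
      using b by (simp add: G_def o_def)
  qed
  have "homeomorphic_maps (subtopology (powertop_real I) (tanh_system I C)) (subtopology ?P L) F G"
    unfolding homeomorphic_maps_def
  proof (intro conjI ballI)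
    show "continuous_map (subtopology (powertop_real I) (tanh_system I C)) (subtopology ?P L) F"
      using contF FL by (auto simp: continuous_map_in_subtopology continuous_map_from_subtopology)
    show "continuous_map (subtopology ?P L) (subtopology (powertop_real I) (tanh_system I C)) G"
      using contG GK by (auto simp: continuous_map_in_subtopology)
  qed (use GF FG in \<open>auto simp: PiE_def\<close>)
  then have "subtopology (powertop_real I) (tanh_system I C) homeomorphic_space diagram_limit Obj Arr src' tgt' X' f'"
    using lim homeomorphic_space_trans homeomorphic_maps_imp_homeomorphic_space by blast
  then show ?thesis
    using diag objs by (intro exI conjI) (auto simp: X_def N_def)
qed

section \<open>Slices of quotients and orthogonal projection\<close>

section \<open>Slices and definable conditions\<close>

text \<open>\<open>r\<close> chooses one point of \<open>S\<close> in each fibre of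
  \<open>p\<close>. Being constant on fibres it descends to \<open>Y\<close>, and the descended map
  is inverse to the restriction of \<open>p\<close>.\<close>

lemma quotient_homeomorphic_slice:
  assumes p: "quotient_map X Y p" and r: "continuous_map X X r"
    and rS: "\<And>x. x \<in> topspace X \<Longrightarrow> r x \<in> S"
    and pr: "\<And>x. x \<in> topspace X \<Longrightarrow> p (r x) = p x"
    and inv: "\<And>x y. x \<in> topspace X \<Longrightarrow> y \<in> topspace X \<Longrightarrow> p x = p y \<Longrightarrow> r x = r y"
    and fix_S: "\<And>x. x \<in> topspace X \<Longrightarrow> x \<in> S \<Longrightarrow> r x = x"
  shows "Y homeomorphic_space subtopology X S"
proof -
  have "continuous_map X (subtopology X S) r"
    using r rS by (auto simp: continuous_map_in_subtopology)
  then have "\<exists>g. continuous_map Y (subtopology X S) g \<and> (\<forall>x\<in>topspace X. g (p x) = r x)"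
    by (rule quotient_map_lift_exists[OF p]) (use inv in blast)+
  then obtain g where g: "continuous_map Y (subtopology X S) g"
      and gp: "\<And>x. x \<in> topspace X \<Longrightarrow> g (p x) = r x"
    by blast
  have cp: "continuous_map (subtopology X S) Y p"
    using quotient_imp_continuous_map[OF p] by (rule continuous_map_from_subtopology)
  have surj: "p ` topspace X = topspace Y"
    using p by (rule quotient_imp_surjective_map)
  have pg: "p (g y) = y" if "y \<in> topspace Y" for y
  proof -
    from that surj obtain x where "x \<in> topspace X" "y = p x" by blast
    then show ?thesis by (simp add: gp pr)
  qed
  have "g (p x) = x" if "x \<in> topspace (subtopology X S)" for x
    using that by (simp add: gp fix_S)
  then have "homeomorphic_maps Y (subtopology X S) g p"
    unfolding homeomorphic_maps_def using g cp pg by blast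
  then show ?thesis by (rule homeomorphic_maps_imp_homeomorphic_space)
qed

text \<open>Gram-Schmidt, one vector at a time, with dependent vectors allowed. The coefficients
  \<open>s j x\<close> are kept because they become logarithms of torus parameters.\<close>

lemma continuous_orthogonal_projection:
  fixes w :: "'j \<Rightarrow> 'i \<Rightarrow> real"
  assumes I: "finite I" and J: "finite J"
  shows "\<exists>s. (\<forall>j. continuous_map (powertop_real I) euclideanreal (s j)) \<and>
    (\<forall>x. \<forall>j\<in>J. (\<Sum>b\<in>I. w j b * (x b + (\<Sum>i\<in>J. s i x * w i b))) = 0)"
  using J
proof (induction J)
  case empty
  show ?case by (intro exI[of _ "\<lambda>_ _. 0"]) auto
next
  case (insert k J)
  then obtain s where s: "\<And>j. continuous_map (powertop_real I) euclideanreal (s j)"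
    and orth: "\<And>x j. j \<in> J \<Longrightarrow> (\<Sum>b\<in>I. w j b * (x b + (\<Sum>i\<in>J. s i x * w i b))) = 0"
    by blast
  \<comment> \<open>\<open>P x\<close> is \<open>x\<close> made orthogonal to the vectors of
    \<open>J\<close>.\<close>
  define P where "P = (\<lambda>x b. x b + (\<Sum>i\<in>J. s i x * w i b))"
  define ip where "ip = (\<lambda>x y :: 'i \<Rightarrow> real. \<Sum>b\<in>I. x b * y b)"
  have orth: "ip (w j) (P x) = 0" if "j \<in> J" for j x
    using orth[OF that] by (simp add: ip_def P_def)
  \<comment> \<open>The part of the new vector that is orthogonal to the old ones.\<close>
  define w' where "w' = P (w k)"
  have wk: "w k b = w' b - (\<Sum>i\<in>J. s i (w k) * w i b)" for b
    by (simp add: w'_def P_def)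
  have ipk: "ip (w k) y = ip w' y - (\<Sum>i\<in>J. s i (w k) * ip (w i) y)" for y
  proof -
    have "ip (w k) y = (\<Sum>b\<in>I. w' b * y b - (\<Sum>i\<in>J. s i (w k) * (w i b * y b)))"
      unfolding ip_def by (rule sum.cong[OF refl]) (subst wk, simp add: left_diff_distrib sum_distrib_right mult.assoc)
    also have "\<dots> = ip w' y - (\<Sum>b\<in>I. \<Sum>i\<in>J. s i (w k) * (w i b * y b))"
      by (simp add: ip_def sum_subtractf)
    also have "(\<Sum>b\<in>I. \<Sum>i\<in>J. s i (w k) * (w i b * y b)) = (\<Sum>i\<in>J. s i (w k) * ip (w i) y)"
      by (subst sum.swap) (simp add: ip_def sum_distrib_left)
    finally show ?thesis .
  qed
  have ipk_P: "ip (w k) (P x) = ip w' (P x)" for x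
    by (simp add: ipk orth)
  define N where "N = ip w' w'"
  \<comment> \<open>For \<open>N = 0\<close> division by zero yields 0; then \<open>w'\<close>
    vanishes on \<open>I\<close> and no correction is required.\<close>
  define a where "a = (\<lambda>x. - ip (w k) (P x) / N)"
  \<comment> \<open>The correction \<open>a x * w'\<close> is expanded in the given vectors:
    \<open>w'\<close> is \<open>w k\<close> plus the combination of the \<open>w i\<close> with
    coefficients \<open>s i (w k)\<close>.\<close>
  define s' where "s' = (\<lambda>j x. if j = k then a x else s j x + a x * s j (w k))"
  have cont_s: "continuous_map (powertop_real I) euclideanreal (\<lambda>x. s j x)" for j
    using s by simp
  have "continuous_map (powertop_real I) euclideanreal (\<lambda>x. ip (w k) (P x))"
    unfolding ip_def P_def using I insert.hyps
    by (intro continuous_intros cont_s continuous_map_product_projection) auto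
  then have cont_a: "continuous_map (powertop_real I) euclideanreal a"
    unfolding a_def divide_inverse by (intro continuous_intros)
  have cont: "continuous_map (powertop_real I) euclideanreal (s' j)" for j
    unfolding s'_def using cont_a by (cases "j = k") (auto intro!: continuous_intros cont_s)
  have sum_s': "x b + (\<Sum>i\<in>insert k J. s' i x * w i b) = P x b + a x * w' b" for x b
  proof -
    have "(\<Sum>i\<in>J. s' i x * w i b) = (\<Sum>i\<in>J. (s i x + a x * s i (w k)) * w i b)"
      using insert.hyps by (intro sum.cong) (auto simp: s'_def)
    also have "\<dots> = (\<Sum>i\<in>J. s i x * w i b) + a x * (\<Sum>i\<in>J. s i (w k) * w i b)"
      by (simp add: algebra_simps sum.distrib sum_distrib_left)
    finally show ?thesis
      using insert.hyps by (simp add: s'_def P_def wk[of b] algebra_simps)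
  qed
  have lin: "(\<Sum>b\<in>I. w j b * (P x b + a x * w' b)) = ip (w j) (P x) + a x * ip (w j) w'" for j x
    by (simp add: ip_def algebra_simps sum.distrib sum_distrib_left)
  have "(\<Sum>b\<in>I. w j b * (P x b + a x * w' b)) = 0" if "j \<in> insert k J" for j x
  proof (cases "j = k")
    case False
    then have "j \<in> J" using that by simp
    then show ?thesis using orth[of j x] orth[of j "w k"] unfolding lin by (simp add: w'_def)
  next
    case True
    show ?thesis
    proof (cases "N = 0")
      case True
      then have "w' b = 0" if "b \<in> I" for b
        using that I by (simp add: N_def ip_def sum_nonneg_eq_0_iff)
      then have "ip w' y = 0" for y by (simp add: ip_def)
      then show ?thesis using ipk_P[of x] True unfolding lin \<open>j = k\<close> by (simp add: a_def)
    next
      case False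
      have "ip (w k) w' = N" using ipk_P[of "w k"] by (simp add: w'_def N_def)
      then show ?thesis using False unfolding lin \<open>j = k\<close> by (simp add: a_def)
    qed
  qed
  then show ?case
    using cont by (intro exI[of _ s']) (simp add: sum_s' del: sum.insert)
qed

section \<open>Conditions given by closed relations between pairs of tangents\<close>

definition tanh_definable :: "'i set \<Rightarrow> (('i \<Rightarrow> real) \<Rightarrow> bool) \<Rightarrow> bool" where
  "tanh_definable I P \<longleftrightarrow> (\<exists>C. (\<forall>s. closed (C s)) \<and> (\<forall>y. P y \<longleftrightarrow> y \<in> tanh_system I C))"

text \<open>Arbitrary intersections of closed sets are closed, so \<open>J\<close> may be
  infinite.\<close>

lemma tanh_definable_all:
  assumes "\<And>j. j \<in> J \<Longrightarrow> tanh_definable I (P j)"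
  shows "tanh_definable I (\<lambda>y. \<forall>j\<in>J. P j y)"
proof -
  obtain C where C: "\<And>j s. j \<in> J \<Longrightarrow> closed (C j s)"
      "\<And>j y. j \<in> J \<Longrightarrow> P j y \<longleftrightarrow> y \<in> tanh_system I (C j)"
    using assms unfolding tanh_definable_def by metis
  show ?thesis
    unfolding tanh_definable_def
    by (intro exI[of _ "\<lambda>s. \<Inter>j\<in>J. C j s"]) (auto simp: C tanh_system_def)
qed

lemma tanh_definable_conj:
  assumes "tanh_definable I P" "tanh_definable I Q"
  shows "tanh_definable I (\<lambda>y. P y \<and> Q y)"
proof -
  have "tanh_definable I (\<lambda>y. \<forall>b\<in>UNIV. (if b then P else Q) y)"
    using assms by (intro tanh_definable_all) auto
  then show ?thesis by (simp add: all_bool_eq)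
qed

lemma tanh_definable_basic:
  assumes "l \<in> box2 I" "m \<in> box2 I" "closed D"
  shows "tanh_definable I (\<lambda>y. (tanh (pairing I l y), tanh (pairing I m y)) \<in> D)"
  unfolding tanh_definable_def
  using assms
  by (intro exI[of _ "\<lambda>s. if s = (l, m) then D else UNIV"]) (auto simp: tanh_system_def)

text \<open>The false condition is the empty relation at the pair \<open>(0, 0)\<close>.\<close>

lemma tanh_definable_const: "tanh_definable I (\<lambda>_. b)"
  using tanh_definable_basic[of 0 I 0 "if b then UNIV else {}"] by (cases b) auto

lemma tanh_definable_eq_0:
  assumes "l \<in> box2 I"
  shows "tanh_definable I (\<lambda>y. pairing I l y = 0)"
proof -
  have "closed {z :: real \<times> real. fst z = 0}"
    by (intro closed_Collect_eq continuous_intros)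
  from tanh_definable_basic[OF assms assms this] show ?thesis by simp
qed

lemma tanh_definable_le_0:
  assumes "l \<in> box2 I"
  shows "tanh_definable I (\<lambda>y. pairing I l y \<le> 0)"
proof -
  have "closed {z :: real \<times> real. fst z \<le> 0}"
    by (intro closed_Collect_le continuous_intros)
  from tanh_definable_basic[OF assms assms this] show ?thesis by simp
qed

text \<open>Dividing by \<open>exp (2 * c)\<close> leaves \<open>A \<le> B + 1\<close>, where
  \<open>A = (1 + u) / (1 - u)\<close> and \<open>B = (1 + v) / (1 - v)\<close> for the two tangents
  \<open>u\<close> and \<open>v\<close>. Clearing denominators gives a polynomial inequality, which
  is closed in the plane.\<close>

lemma exp_le_exp_add_exp_iff:
  fixes a b c :: real
  shows "exp (2 * a) \<le> exp (2 * b) + exp (2 * c) \<longleftrightarrow>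
    (1 + tanh (a - c)) * (1 - tanh (b - c)) \<le> 2 * (1 - tanh (a - c))"
proof -
  define A where "A = exp (2 * (a - c))"
  define B where "B = exp (2 * (b - c))"
  have pos: "0 < A" "0 < B" by (simp_all add: A_def B_def)
  have tanh_exp: "tanh y = (exp (2 * y) - 1) / (exp (2 * y) + 1)" for y :: real
  proof -
    have "exp (- 2 * y) = 1 / exp (2 * y)" by (simp add: exp_minus inverse_eq_divide)
    moreover have "1 + exp (2 * y) > 0" by (simp add: add_pos_pos)
    ultimately show ?thesis
      unfolding tanh_real_altdef by (simp only:) (simp add: divide_simps)
  qed
  have u: "tanh (a - c) = (A - 1) / (A + 1)" and v: "tanh (b - c) = (B - 1) / (B + 1)"
    by (simp_all only: A_def B_def tanh_exp)
  have "(1 + tanh (a - c)) * (1 - tanh (b - c)) = 4 * A / ((A + 1) * (B + 1))"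
    "2 * (1 - tanh (a - c)) = 4 * (B + 1) / ((A + 1) * (B + 1))"
    unfolding u v using pos by (simp_all add: divide_simps)
  then have "(1 + tanh (a - c)) * (1 - tanh (b - c)) \<le> 2 * (1 - tanh (a - c)) \<longleftrightarrow> A \<le> B + 1"
    using pos by (auto simp: divide_le_cancel mult_less_0_iff)
  moreover have "exp (2 * a) = A * exp (2 * c)" "exp (2 * b) = B * exp (2 * c)"
    by (simp_all add: A_def B_def exp_add[symmetric] algebra_simps)
  then have "exp (2 * a) \<le> exp (2 * b) + exp (2 * c) \<longleftrightarrow> A * exp (2 * c) \<le> (B + 1) * exp (2 * c)"
    by (simp add: algebra_simps)
  ultimately show ?thesis by simp
qed

text \<open>After division by the last exponential only differences of forms remain, so it is these
  that must lie in the box.\<close>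

lemma tanh_definable_exp_le:
  assumes "l - k \<in> box2 I" "m - k \<in> box2 I"
  shows "tanh_definable I (\<lambda>y. exp (2 * pairing I l y) \<le> exp (2 * pairing I m y) + exp (2 * pairing I k y))"
proof -
  have "closed {z :: real \<times> real. (1 + fst z) * (1 - snd z) \<le> 2 * (1 - fst z)}"
    by (intro closed_Collect_le continuous_intros)
  from tanh_definable_basic[OF assms this] show ?thesis
    by (simp add: exp_le_exp_add_exp_iff pairing_diff)
qed

section \<open>Three-term relations and torus orbits\<close>

section \<open>Weak representations and the torus action\<close>

definition quads :: "nat \<Rightarrow> nat \<Rightarrow> nat set set \<Rightarrow> ((nat \<Rightarrow> nat) \<times> nat \<times> nat \<times> nat \<times> nat) set" where
  "quads n d \<B> = {(\<alpha>, i, j, k, l). 2 \<le> d \<and> \<alpha> \<in> Delta n (d - 2) \<and>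
     i \<in> {1..n} \<and> j \<in> {1..n} \<and> k \<in> {1..n} \<and> l \<in> {1..n} \<and> i \<le> j \<and> j \<le> k \<and> k \<le> l \<and>
     lower_vec (basis_vectors \<B>) \<le> \<alpha> \<and>
     \<alpha> + unit_vec i + unit_vec j + unit_vec k + unit_vec l \<le> upper_vec (basis_vectors \<B>)}"

text \<open>Products in the relations may involve nonbases, where a representation is 0.\<close>

definition ext0 :: "(nat \<Rightarrow> nat) set \<Rightarrow> ((nat \<Rightarrow> nat) \<Rightarrow> real) \<Rightarrow> (nat \<Rightarrow> nat) \<Rightarrow> real" where
  "ext0 I x \<gamma> = (if \<gamma> \<in> I then x \<gamma> else 0)"

definition pluecker3 :: "real \<Rightarrow> ((nat \<Rightarrow> nat) \<Rightarrow> real) \<Rightarrow> (nat \<Rightarrow> nat) \<times> nat \<times> nat \<times> nat \<times> nat \<Rightarrow> bool" where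
  "pluecker3 q \<rho> = (\<lambda>(\<alpha>, i, j, k, l).
     Tq_null q
       (\<rho> (\<alpha> + unit_vec j + unit_vec k) * \<rho> (\<alpha> + unit_vec i + unit_vec l))
       (\<rho> (\<alpha> + unit_vec i + unit_vec k) * \<rho> (\<alpha> + unit_vec j + unit_vec l))
       (\<rho> (\<alpha> + unit_vec i + unit_vec j) * \<rho> (\<alpha> + unit_vec k + unit_vec l)))"

lemma weak_Tq_rep_iff:
  "weak_Tq_rep n d \<B> q \<rho> \<longleftrightarrow>
     \<rho> \<in> Delta n d \<rightarrow>\<^sub>E {0..} \<and> {\<alpha> \<in> Delta n d. \<rho> \<alpha> \<noteq> 0} = basis_vectors \<B> \<and>
     (\<forall>t\<in>quads n d \<B>. pluecker3 q \<rho> t)"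
  unfolding weak_Tq_rep_def quads_def pluecker3_def by blast

lemma Delta_add_unit_vecs:
  assumes "\<alpha> \<in> Delta n (d - 2)" "2 \<le> d" "i \<in> {1..n}" "j \<in> {1..n}"
  shows "\<alpha> + unit_vec i + unit_vec j \<in> Delta n d"
proof -
  have "(\<Sum>m\<in>{1..n}. unit_vec i m) = 1" if "i \<in> {1..n}" for i
    using that by (simp add: unit_vec_def indicator_def)
  then show ?thesis
    using assms by (auto simp: Delta_def sum.distrib unit_vec_def)
qed

text \<open>The relation is homogeneous; this is what makes it invariant under the torus.\<close>

lemma Tq_null_scale:
  assumes "0 < s" "0 \<le> a" "0 \<le> b" "0 \<le> c"
  shows "Tq_null q (s * a) (s * b) (s * c) \<longleftrightarrow> Tq_null q a b c"
  using assms by (simp add: Tq_null_def powr_mult distrib_left[symmetric])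

text \<open>In logarithmic coordinates the torus acts by translation along the vectors
  \<open>\<beta> \<mapsto> real (\<beta> i)\<close>.\<close>

lemma ln_torus:
  fixes t :: "nat \<Rightarrow> real"
  assumes "\<And>i. i \<in> {1..n} \<Longrightarrow> 0 < t i" "0 < y"
  shows "ln ((\<Prod>i\<in>{1..n}. t i ^ \<beta> i) * y) = ln y + (\<Sum>i\<in>{1..n}. ln (t i) * real (\<beta> i))"
proof -
  have "ln (\<Prod>i\<in>{1..n}. t i ^ \<beta> i) = (\<Sum>i\<in>{1..n}. ln (t i) * real (\<beta> i))"
  proof (subst ln_prod)
    show "(\<Sum>i\<in>{1..n}. ln (t i ^ \<beta> i)) = (\<Sum>i\<in>{1..n}. ln (t i) * real (\<beta> i))"
      using assms by (intro sum.cong) (auto simp: ln_realpow)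
  qed (use assms(1) in \<open>fastforce+\<close>)
  moreover have "(\<Prod>i\<in>{1..n}. t i ^ \<beta> i) > 0" using assms by (intro prod_pos) auto
  note ln_mult_pos[OF this assms(2)]
  ultimately show ?thesis by linarith
qed

lemma torus_act_torus_act:
  "torus_act n \<B> s (torus_act n \<B> t x) = torus_act n \<B> (\<lambda>i. s i * t i) x"
  by (auto simp: torus_act_def fun_eq_iff prod.distrib power_mult_distrib)

lemma torus_act_one: "x \<in> extensional (basis_vectors \<B>) \<Longrightarrow> torus_act n \<B> (\<lambda>_. 1) x = x"
  by (auto simp: torus_act_def fun_eq_iff extensional_def)

lemma torus_act_cong:
  "(\<And>i. i \<in> {1..n} \<Longrightarrow> s i = t i) \<Longrightarrow> torus_act n \<B> s x = torus_act n \<B> t x"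
  by (auto simp: torus_act_def fun_eq_iff intro!: prod.cong)

lemma torus_orbit_self: "x \<in> extensional (basis_vectors \<B>) \<Longrightarrow> x \<in> torus_orbit n \<B> x"
  unfolding torus_orbit_def using torus_act_one[of x \<B> n] by (auto intro!: exI[of _ "\<lambda>_. 1"])

lemma torus_orbit_act:
  assumes x: "x \<in> extensional (basis_vectors \<B>)" and t: "\<forall>i\<in>{1..n}. 0 < t i"
  shows "torus_orbit n \<B> (torus_act n \<B> t x) = torus_orbit n \<B> x"
proof
  show "torus_orbit n \<B> (torus_act n \<B> t x) \<subseteq> torus_orbit n \<B> x"
  proof
    fix z assume "z \<in> torus_orbit n \<B> (torus_act n \<B> t x)"
    then obtain s where "\<forall>i\<in>{1..n}. 0 < s i" "z = torus_act n \<B> (\<lambda>i. s i * t i) x"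
      by (auto simp: torus_orbit_def torus_act_torus_act)
    then show "z \<in> torus_orbit n \<B> x"
      unfolding torus_orbit_def using t by (intro CollectI exI[of _ "\<lambda>i. s i * t i"]) auto
  qed
  show "torus_orbit n \<B> x \<subseteq> torus_orbit n \<B> (torus_act n \<B> t x)"
  proof
    fix z assume "z \<in> torus_orbit n \<B> x"
    then obtain s where s: "\<forall>i\<in>{1..n}. 0 < s i" "z = torus_act n \<B> s x"
      by (auto simp: torus_orbit_def)
    then have "z = torus_act n \<B> (\<lambda>i. s i / t i) (torus_act n \<B> t x)"
      unfolding torus_act_torus_act s(2) using t by (intro torus_act_cong) (auto simp: less_le)
    then show "z \<in> torus_orbit n \<B> (torus_act n \<B> t x)"
      unfolding torus_orbit_def using s t by (intro CollectI exI[of _ "\<lambda>i. s i / t i"]) auto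
  qed
qed

text \<open>The logarithms are orthogonal to the directions in which the torus translates
  them.\<close>

definition log_slice :: "nat \<Rightarrow> (nat \<Rightarrow> nat) set \<Rightarrow> ((nat \<Rightarrow> nat) \<Rightarrow> real) set" where
  "log_slice n I = {x. \<forall>j\<in>{1..n}. (\<Sum>\<beta>\<in>I. real (\<beta> j) * ln (x \<beta>)) = 0}"

text \<open>The change \<open>v\<close> of the logarithms is a combination of torus directions and,
  as a difference of two slice points, orthogonal to all of them; hence it is 0. The torus may act
  with a stabilizer, so \<open>t\<close> itself need not be 1.\<close>

lemma log_slice_unique:
  assumes I: "finite I" "I = basis_vectors \<B>"
    and x: "x \<in> I \<rightarrow>\<^sub>E {0<..}" "x \<in> log_slice n I"
    and t: "\<forall>i\<in>{1..n}. 0 < t i" and slice: "torus_act n \<B> t x \<in> log_slice n I"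
  shows "torus_act n \<B> t x = x"
proof
  fix \<beta>
  define v where "v = (\<lambda>\<beta> :: nat \<Rightarrow> nat. \<Sum>i\<in>{1..n}. ln (t i) * real (\<beta> i))"
  have ln_act: "ln (torus_act n \<B> t x \<beta>) = ln (x \<beta>) + v \<beta>" if "\<beta> \<in> I" for \<beta>
    unfolding v_def using that t x(1) I(2) by (subst ln_torus[symmetric]) (auto simp: torus_act_def PiE_iff)
  have "(\<Sum>\<beta>\<in>I. real (\<beta> j) * v \<beta>) = 0" if "j \<in> {1..n}" for j
  proof -
    have "(\<Sum>\<beta>\<in>I. real (\<beta> j) * v \<beta>) =
        (\<Sum>\<beta>\<in>I. real (\<beta> j) * ln (torus_act n \<B> t x \<beta>)) - (\<Sum>\<beta>\<in>I. real (\<beta> j) * ln (x \<beta>))"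
      unfolding sum_subtractf[symmetric] by (intro sum.cong) (auto simp: ln_act algebra_simps)
    then show ?thesis using that x(2) slice unfolding log_slice_def by auto
  qed
  \<comment> \<open>Weighting the orthogonality relations by \<open>ln (t j)\<close> turns their sum
    into the squared norm of \<open>v\<close>.\<close>
  then have "(\<Sum>j\<in>{1..n}. ln (t j) * (\<Sum>\<beta>\<in>I. real (\<beta> j) * v \<beta>)) = 0" by simp
  also have "(\<Sum>j\<in>{1..n}. ln (t j) * (\<Sum>\<beta>\<in>I. real (\<beta> j) * v \<beta>)) = (\<Sum>\<beta>\<in>I. v \<beta> * v \<beta>)"
    unfolding sum_distrib_left by (subst sum.swap) (simp add: v_def sum_distrib_right mult.assoc)
  finally have "v \<beta> = 0" if "\<beta> \<in> I" for \<beta>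
    using that I(1) by (simp add: sum_nonneg_eq_0_iff)
  then have eq: "ln (torus_act n \<B> t x \<beta>) = ln (x \<beta>)" if "\<beta> \<in> I" using that ln_act by simp
  show "torus_act n \<B> t x \<beta> = x \<beta>"
  proof (cases "\<beta> \<in> I")
    case True
    then have "0 < x \<beta>" using x(1) by auto
    moreover have "0 < torus_act n \<B> t x \<beta>"
      using True I(2) t \<open>0 < x \<beta>\<close> by (auto simp: torus_act_def intro!: mult_pos_pos prod_pos)
    ultimately show ?thesis using eq[OF True] by simp
  next
    case False
    then show ?thesis using x(1) I(2) by (auto simp: torus_act_def PiE_def extensional_def)
  qed
qed

section \<open>Representations as positive functions on the bases\<close>

context matroid_by_bases
begin

abbreviation "I \<equiv> basis_vectors \<B>"

lemma finite_basis_vectors: "finite I"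
proof -
  have "\<B> \<subseteq> Pow {1..n}" using bases_subset by blast
  then show ?thesis unfolding basis_vectors_def by (metis finite_Pow_iff finite_atLeastAtMost finite_imageI finite_subset)
qed

lemma basis_vectors_le_1: "\<beta> \<in> I \<Longrightarrow> \<beta> i \<le> 1"
  by (auto simp: basis_vectors_def indicator_def)

lemma basis_vectors_subset_Delta: "I \<subseteq> Delta n d"
proof
  fix \<beta> assume "\<beta> \<in> I"
  then obtain B where B: "B \<in> \<B>" "\<beta> = indicator B" by (auto simp: basis_vectors_def)
  then have "B \<subseteq> {1..n}" "card B = d" using bases_subset bases_card by auto
  then show "\<beta> \<in> Delta n d"
    by (auto simp: B(2) Delta_def sum_indicator_eq_card Int_absorb1 indicator_def subset_iff)
qed

definition positive_reps :: "real \<Rightarrow> ((nat \<Rightarrow> nat) \<Rightarrow> real) set" where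
  "positive_reps q = {x \<in> I \<rightarrow>\<^sub>E {0<..}. \<forall>t\<in>quads n d \<B>. pluecker3 q (ext0 I x) t}"

lemma pluecker3_cong:
  assumes "\<And>\<gamma>. \<gamma> \<in> Delta n d \<Longrightarrow> \<rho> \<gamma> = \<rho>' \<gamma>" "t \<in> quads n d \<B>"
  shows "pluecker3 q \<rho> t \<longleftrightarrow> pluecker3 q \<rho>' t"
proof -
  obtain \<alpha> i j k l where t: "t = (\<alpha>, i, j, k, l)" by (cases t)
  have "\<rho> (\<alpha> + unit_vec r + unit_vec s) = \<rho>' (\<alpha> + unit_vec r + unit_vec s)"
    if "r \<in> {i,j,k,l}" "s \<in> {i,j,k,l}" for r s
    using that assms(2) unfolding t quads_def by (intro assms(1) Delta_add_unit_vecs) auto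
  then show ?thesis by (simp add: t pluecker3_def)
qed

text \<open>The support is exactly the set of bases, so restriction to it loses nothing; extension
  by 0 leads back.\<close>

lemma restrict_weak_reps:
  "(\<lambda>\<rho>. restrict \<rho> I) ` {\<rho>. weak_Tq_rep n d \<B> q \<rho>} = positive_reps q"
proof (intro subset_antisym subsetI)
  fix x assume "x \<in> (\<lambda>\<rho>. restrict \<rho> I) ` {\<rho>. weak_Tq_rep n d \<B> q \<rho>}"
  then obtain \<rho> where x: "x = restrict \<rho> I" and \<rho>: "\<rho> \<in> Delta n d \<rightarrow>\<^sub>E {0..}"
      "{\<alpha> \<in> Delta n d. \<rho> \<alpha> \<noteq> 0} = I" "\<And>t. t \<in> quads n d \<B> \<Longrightarrow> pluecker3 q \<rho> t"
    by (auto simp: weak_Tq_rep_iff)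
  have "0 < \<rho> \<beta>" if "\<beta> \<in> I" for \<beta>
  proof -
    have "\<beta> \<in> Delta n d" "\<rho> \<beta> \<noteq> 0" using that \<rho>(2) by auto
    then show ?thesis using \<rho>(1) by (auto simp: PiE_iff less_le)
  qed
  then have "x \<in> I \<rightarrow>\<^sub>E {0<..}" by (auto simp: x)
  moreover have "ext0 I x \<gamma> = \<rho> \<gamma>" if "\<gamma> \<in> Delta n d" for \<gamma>
    using that \<rho>(2) by (auto simp: ext0_def x)
  then have "pluecker3 q (ext0 I x) t" if "t \<in> quads n d \<B>" for t
    using that \<rho>(3) pluecker3_cong by blast
  ultimately show "x \<in> positive_reps q" by (simp add: positive_reps_def)
next
  fix x assume x: "x \<in> positive_reps q"
  define \<rho> where "\<rho> = restrict (ext0 I x) (Delta n d)"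
  have pos: "0 < x \<beta>" if "\<beta> \<in> I" for \<beta> using x that by (auto simp: positive_reps_def)
  have "\<rho> \<in> Delta n d \<rightarrow>\<^sub>E {0..}"
    using pos by (auto simp: \<rho>_def ext0_def less_imp_le)
  moreover have "{\<alpha> \<in> Delta n d. \<rho> \<alpha> \<noteq> 0} = I"
    using pos basis_vectors_subset_Delta by (auto simp: \<rho>_def ext0_def less_le)
  moreover have "pluecker3 q \<rho> t" if "t \<in> quads n d \<B>" for t
    using that x pluecker3_cong[of \<rho> "ext0 I x" t q] by (auto simp: \<rho>_def positive_reps_def)
  ultimately have "weak_Tq_rep n d \<B> q \<rho>" by (simp add: weak_Tq_rep_iff)
  moreover have "x = restrict \<rho> I"
    using x basis_vectors_subset_Delta
    by (auto simp: positive_reps_def \<rho>_def ext0_def fun_eq_iff PiE_def extensional_def)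
  ultimately show "x \<in> (\<lambda>\<rho>. restrict \<rho> I) ` {\<rho>. weak_Tq_rep n d \<B> q \<rho>}" by blast
qed

lemma torus_act_positive:
  assumes "x \<in> I \<rightarrow>\<^sub>E {0<..}" "\<forall>i\<in>{1..n}. 0 < t i"
  shows "torus_act n \<B> t x \<in> I \<rightarrow>\<^sub>E {0<..}"
  using assms by (auto simp: torus_act_def PiE_iff intro!: mult_pos_pos prod_pos)

text \<open>The three products of a relation have the same multidegree, so the torus multiplies them
  by one common factor \<open>c\<close>.\<close>

lemma torus_act_positive_reps:
  assumes x: "x \<in> positive_reps q" and t: "\<forall>i\<in>{1..n}. 0 < t i"
  shows "torus_act n \<B> t x \<in> positive_reps q"
proof -
  have pos: "x \<in> I \<rightarrow>\<^sub>E {0<..}" using x by (simp add: positive_reps_def)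
  define mono where "mono = (\<lambda>\<gamma> :: nat \<Rightarrow> nat. \<Prod>i\<in>{1..n}. t i ^ \<gamma> i)"
  have mono_add: "mono (\<gamma> + \<delta>) = mono \<gamma> * mono \<delta>" for \<gamma> \<delta>
    by (simp add: mono_def power_add prod.distrib)
  have mono_pos: "0 < mono \<gamma>" for \<gamma> unfolding mono_def using t by (intro prod_pos) auto
  have ext: "ext0 I (torus_act n \<B> t x) \<gamma> = mono \<gamma> * ext0 I x \<gamma>" for \<gamma>
    by (simp add: ext0_def torus_act_def mono_def)
  have nonneg: "0 \<le> ext0 I x \<gamma>" for \<gamma> using pos by (auto simp: ext0_def PiE_iff less_imp_le)
  have "pluecker3 q (ext0 I (torus_act n \<B> t x)) s" if s: "s \<in> quads n d \<B>" for s
  proof -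
    obtain \<alpha> i j k l where eq: "s = (\<alpha>, i, j, k, l)" by (cases s)
    define c where "c = mono (\<alpha> + \<alpha> + unit_vec i + unit_vec j + unit_vec k + unit_vec l)"
    have prod: "ext0 I (torus_act n \<B> t x) \<gamma> * ext0 I (torus_act n \<B> t x) \<delta> =
        mono (\<gamma> + \<delta>) * (ext0 I x \<gamma> * ext0 I x \<delta>)" for \<gamma> \<delta>
      by (simp add: ext mono_add)
    have c: "mono (\<alpha> + unit_vec j + unit_vec k + (\<alpha> + unit_vec i + unit_vec l)) = c"
        "mono (\<alpha> + unit_vec i + unit_vec k + (\<alpha> + unit_vec j + unit_vec l)) = c"
        "mono (\<alpha> + unit_vec i + unit_vec j + (\<alpha> + unit_vec k + unit_vec l)) = c"
      by (simp_all add: c_def mono_add)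
    have "pluecker3 q (ext0 I x) s" using x s by (simp add: positive_reps_def)
    then show ?thesis
      unfolding eq pluecker3_def prod.case prod c
      by (simp add: Tq_null_scale nonneg mono_pos c_def)
  qed
  then show ?thesis using torus_act_positive[OF pos t] by (simp add: positive_reps_def)
qed

end

section \<open>The quotient as a logarithmic slice\<close>

context matroid_by_bases
begin

lemma topspace_weak_rep_space: "topspace (weak_rep_space n d \<B> q) = positive_reps q"
  unfolding weak_rep_space_def restrict_weak_reps by (auto simp: positive_reps_def)

text \<open>Orthogonal projection of the logarithms moves each representation continuously within
  its orbit to the slice, and by \<open>log_slice_unique\<close> the slice meets an orbit only
  once.\<close>

lemma Gr_homeomorphic_slice:
  "Gr_weak_Tq n d \<B> q homeomorphic_space subtopology (weak_rep_space n d \<B> q) (log_slice n I)"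
proof -
  let ?X = "weak_rep_space n d \<B> q"
  let ?pos = "top_of_set {0<..} :: real topology"
  obtain s where s: "\<And>j. continuous_map (powertop_real I) euclideanreal (s j)"
    and orth: "\<And>x j. j \<in> {1..n} \<Longrightarrow>
      (\<Sum>\<beta>\<in>I. real (\<beta> j) * (x \<beta> + (\<Sum>i\<in>{1..n}. s i x * real (\<beta> i)))) = 0"
    using continuous_orthogonal_projection[OF finite_basis_vectors finite_atLeastAtMost[of 1 n],
        of "\<lambda>j \<beta>. real (\<beta> j)"] by blast
  define lnmap :: "((nat \<Rightarrow> nat) \<Rightarrow> real) \<Rightarrow> (nat \<Rightarrow> nat) \<Rightarrow> real" where
    "lnmap = (\<lambda>x. \<lambda>\<beta>\<in>I. ln (x \<beta>))"
  \<comment> \<open>Acting by these parameters adds to the logarithms exactly the correction that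
    appears in \<open>orth\<close>.\<close>
  define t where "t = (\<lambda>x i. exp (s i (lnmap x)))"
  define r where "r = (\<lambda>x. torus_act n \<B> (t x) x)"
  have t_pos: "\<forall>i\<in>{1..n}. 0 < t x i" for x by (simp add: t_def)
  have posE: "x \<in> I \<rightarrow>\<^sub>E {0<..}" "x \<in> extensional I" if "x \<in> positive_reps q" for x
    using that by (auto simp: positive_reps_def PiE_def)
  have coord: "continuous_map ?X ?pos (\<lambda>x. x \<beta>)" if "\<beta> \<in> I" for \<beta>
    unfolding weak_rep_space_def
    by (intro continuous_map_from_subtopology continuous_map_product_projection that)
  have "continuous_map ?X euclideanreal (\<lambda>x. ln (x \<beta>))" if "\<beta> \<in> I" for \<beta>
  proof -
    have "continuous_map ?pos euclideanreal ln"
      by (simp add: continuous_on_ln continuous_on_id)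
    from continuous_map_compose[OF coord[OF that] this] show ?thesis by (simp add: o_def)
  qed
  then have "continuous_map ?X (powertop_real I) lnmap"
    unfolding continuous_map_componentwise by (auto simp: lnmap_def)
  from continuous_map_compose[OF this s]
  have cs: "continuous_map ?X euclideanreal (\<lambda>x. s i (lnmap x))" for i by (simp add: o_def)
  have ct: "continuous_map ?X euclideanreal (\<lambda>x. t x i)" for i
    using continuous_map_compose[OF cs[of i], of euclideanreal exp]
    by (simp add: o_def t_def continuous_on_exp continuous_on_id)
  have r_reps: "r x \<in> positive_reps q" if "x \<in> positive_reps q" for x
    unfolding r_def using torus_act_positive_reps[OF that t_pos] .
  have "continuous_map ?X (product_topology (\<lambda>_. ?pos) I) r"
    unfolding continuous_map_componentwise
  proof (intro conjI ballI)
    show "r ` topspace ?X \<subseteq> extensional I"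
      using r_reps posE(2) by (auto simp: topspace_weak_rep_space)
    fix \<beta> assume \<beta>: "\<beta> \<in> I"
    have "continuous_map ?X euclideanreal (\<lambda>x. x \<beta>)"
      using coord[OF \<beta>] by (simp add: continuous_map_in_subtopology)
    then have "continuous_map ?X euclideanreal (\<lambda>x. (\<Prod>i\<in>{1..n}. t x i ^ \<beta> i) * x \<beta>)"
      by (intro continuous_intros ct) auto
    then have "continuous_map ?X euclideanreal (\<lambda>x. r x \<beta>)"
      using \<beta> by (simp add: r_def torus_act_def)
    moreover have "r x \<beta> \<in> {0<..}" if "x \<in> topspace ?X" for x
      using posE(1)[OF r_reps[of x]] that \<beta> by (auto simp: topspace_weak_rep_space)
    ultimately show "continuous_map ?X ?pos (\<lambda>x. r x \<beta>)"
      by (auto simp: continuous_map_in_subtopology)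
  qed
  then have cr: "continuous_map ?X ?X r"
    using r_reps unfolding weak_rep_space_def restrict_weak_reps
    by (auto simp: continuous_map_in_subtopology weak_rep_space_def[symmetric] restrict_weak_reps
        topspace_weak_rep_space positive_reps_def)
  have r_slice: "r x \<in> log_slice n I" if x: "x \<in> positive_reps q" for x
  proof -
    have "ln (r x \<beta>) = lnmap x \<beta> + (\<Sum>i\<in>{1..n}. s i (lnmap x) * real (\<beta> i))" if \<beta>: "\<beta> \<in> I" for \<beta>
    proof -
      have "0 < x \<beta>" using posE(1)[OF x] \<beta> by auto
      then have "ln (r x \<beta>) = ln (x \<beta>) + (\<Sum>i\<in>{1..n}. ln (t x i) * real (\<beta> i))"
        using ln_torus[of n "t x" "x \<beta>" \<beta>] t_pos \<beta> by (simp add: r_def torus_act_def)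
      then show ?thesis using \<beta> by (simp add: lnmap_def t_def)
    qed
    then show ?thesis using orth[of _ "lnmap x"] by (simp add: log_slice_def)
  qed
  have orbit: "torus_orbit n \<B> (r x) = torus_orbit n \<B> x" if "x \<in> positive_reps q" for x
    unfolding r_def using torus_orbit_act[OF posE(2)[OF that] t_pos] .
  have r_inv: "r x = r y"
    if x: "x \<in> positive_reps q" and y: "y \<in> positive_reps q"
      and eq: "torus_orbit n \<B> x = torus_orbit n \<B> y" for x y
  proof -
    have "r y \<in> torus_orbit n \<B> (r x)"
      using torus_orbit_self[OF posE(2)[OF r_reps[OF y]], of n] orbit[OF x] orbit[OF y] eq by simp
    then obtain t' where t': "\<forall>i\<in>{1..n}. 0 < t' i" "r y = torus_act n \<B> t' (r x)"
      by (auto simp: torus_orbit_def)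
    have "torus_act n \<B> t' (r x) = r x"
      using log_slice_unique[OF finite_basis_vectors refl posE(1)[OF r_reps[OF x]] r_slice[OF x] t'(1)]
        r_slice[OF y] unfolding t'(2) .
    then show ?thesis using t'(2) by simp
  qed
  have r_fix: "r x = x" if "x \<in> positive_reps q" "x \<in> log_slice n I" for x
    using log_slice_unique[OF finite_basis_vectors refl posE(1)[OF that(1)] that(2) t_pos]
      r_slice[OF that(1)] by (simp add: r_def)
  show ?thesis
    unfolding Gr_weak_Tq_def
    by (rule quotient_homeomorphic_slice[OF quotient_map_quotient_topology cr])
      (auto simp: topspace_weak_rep_space r_slice orbit r_fix intro: r_inv)
qed

text \<open>With the factor \<open>2 * q\<close> the exponent \<open>1 / q\<close> cancels and
  leaves \<open>exp (2 * ...)\<close>, the form that matches \<open>tanh\<close>.\<close>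

definition expmap :: "real \<Rightarrow> ((nat \<Rightarrow> nat) \<Rightarrow> real) \<Rightarrow> (nat \<Rightarrow> nat) \<Rightarrow> real" where
  "expmap q y = (\<lambda>\<beta>\<in>I. exp (2 * q * y \<beta>))"

lemma slice_homeomorphic_log:
  assumes q: "0 < q"
    and K: "\<And>y. y \<in> K \<longleftrightarrow> expmap q y \<in> positive_reps q \<inter> log_slice n I"
  shows "subtopology (weak_rep_space n d \<B> q) (log_slice n I) homeomorphic_space subtopology (powertop_real I) K"
proof -
  let ?pos = "top_of_set {0<..} :: real topology"
  define h where "h = (\<lambda>x. \<lambda>\<beta>\<in>I. ln (x \<beta>) / (2 * q))"
  have maps: "homeomorphic_maps (product_topology (\<lambda>_. ?pos) I) (powertop_real I) h (expmap q)"
    unfolding homeomorphic_maps_def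
  proof (intro conjI ballI)
    have coord: "continuous_map (product_topology (\<lambda>_. ?pos) I) euclideanreal (\<lambda>x. g (x \<beta>))"
      if "\<beta> \<in> I" "continuous_on {0<..} g" for \<beta> and g :: "real \<Rightarrow> real"
      using continuous_map_compose[OF continuous_map_product_projection[OF that(1)], of "\<lambda>_. ?pos" euclideanreal g]
        that(2) by (simp add: o_def)
    have "continuous_on {0<..} (\<lambda>r. ln r / (2 * q))"
      using q by (intro continuous_intros) auto
    then show "continuous_map (product_topology (\<lambda>_. ?pos) I) (powertop_real I) h"
      unfolding continuous_map_componentwise using coord by (auto simp: h_def)
    have coord': "continuous_map (powertop_real I) ?pos (\<lambda>y. exp (2 * q * y \<beta>))"
      if "\<beta> \<in> I" for \<beta>
    proof -
      have "continuous_map euclideanreal ?pos (\<lambda>r. exp (2 * q * r))"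
        by (simp add: continuous_map_in_subtopology image_subset_iff) (intro continuous_intros)
      from continuous_map_compose[OF continuous_map_product_projection[OF that] this]
      show ?thesis by (simp add: o_def)
    qed
    then show "continuous_map (powertop_real I) (product_topology (\<lambda>_. ?pos) I) (expmap q)"
      unfolding continuous_map_componentwise by (auto simp: expmap_def)
    fix x assume "x \<in> topspace (product_topology (\<lambda>_. ?pos) I)"
    then show "expmap q (h x) = x"
      using q by (auto simp: expmap_def h_def fun_eq_iff PiE_def extensional_def Pi_iff)
  next
    fix y assume "y \<in> topspace (powertop_real I)"
    then show "h (expmap q y) = y"
      using q by (auto simp: expmap_def h_def fun_eq_iff PiE_def extensional_def)
  qed
  have "homeomorphic_maps (subtopology (product_topology (\<lambda>_. ?pos) I) (positive_reps q \<inter> log_slice n I))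
      (subtopology (powertop_real I) K) h (expmap q)"
  proof (rule homeomorphic_maps_subtopologies_alt[OF maps])
    show "h ` (topspace (product_topology (\<lambda>_. ?pos) I) \<inter> (positive_reps q \<inter> log_slice n I)) \<subseteq> K"
    proof (rule image_subsetI)
      fix x assume x: "x \<in> topspace (product_topology (\<lambda>_. ?pos) I) \<inter> (positive_reps q \<inter> log_slice n I)"
      then have "expmap q (h x) = x"
        using maps unfolding homeomorphic_maps_def by blast
      then show "h x \<in> K" using x K[of "h x"] by simp
    qed
    show "expmap q ` (topspace (powertop_real I) \<inter> K) \<subseteq> positive_reps q \<inter> log_slice n I"
      using K by blast
  qed
  then show ?thesis
    unfolding weak_rep_space_def restrict_weak_reps subtopology_subtopology
    by (rule homeomorphic_maps_imp_homeomorphic_space)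
qed

section \<open>Definability of the slice and of the three-term relations\<close>

lemma tanh_definable_log_slice:
  assumes q: "0 < q"
  shows "tanh_definable I (\<lambda>y. expmap q y \<in> log_slice n I)"
proof -
  \<comment> \<open>Entries of basis vectors are 0 or 1, so these forms lie in the box.\<close>
  define w where "w = (\<lambda>j \<beta>. if \<beta> \<in> I then int (\<beta> j) else 0)"
  have w: "w j \<in> box2 I" for j
    by (auto simp: box2_def w_def dest: basis_vectors_le_1[of _ j])
  have "(\<Sum>\<beta>\<in>I. real (\<beta> j) * ln (expmap q y \<beta>)) = 2 * q * pairing I (w j) y" for j y
    unfolding pairing_def sum_distrib_left
    by (intro sum.cong) (auto simp: expmap_def w_def)
  then have "expmap q y \<in> log_slice n I \<longleftrightarrow> (\<forall>j\<in>{1..n}. pairing I (w j) y = 0)" for y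
    using q by (simp add: log_slice_def)
  then show ?thesis
    using tanh_definable_all[of "{1..n}" I "\<lambda>j y. pairing I (w j) y = 0"] tanh_definable_eq_0[OF w]
    by simp
qed

definition root_term :: "real \<Rightarrow> (nat \<Rightarrow> nat) \<times> (nat \<Rightarrow> nat) \<Rightarrow> ((nat \<Rightarrow> nat) \<Rightarrow> real) \<Rightarrow> real" where
  "root_term q = (\<lambda>(\<gamma>, \<delta>) y. (ext0 I (expmap q y) \<gamma> * ext0 I (expmap q y) \<delta>) powr (1 / q))"

lemma root_term_eq:
  assumes q: "0 < q"
  shows "root_term q (\<gamma>, \<delta>) y =
    (if \<gamma> \<in> I \<and> \<delta> \<in> I then exp (2 * pairing I (basis_fun \<gamma> + basis_fun \<delta>) y) else 0)"
proof (cases "\<gamma> \<in> I \<and> \<delta> \<in> I")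
  case True
  have "root_term q (\<gamma>, \<delta>) y = exp (2 * q * (y \<gamma> + y \<delta>)) powr (1 / q)"
    using True by (simp add: root_term_def ext0_def expmap_def exp_add[symmetric] distrib_left)
  also have "\<dots> = exp (2 * (y \<gamma> + y \<delta>))"
    using q by (simp add: powr_def)
  finally show ?thesis
    using True by (simp add: pairing_add pairing_basis_fun finite_basis_vectors)
qed (auto simp: root_term_def ext0_def)

text \<open>Which of the three terms vanish does not depend on \<open>y\<close>. The cases leave a
  constant condition, a comparison of two linear forms, or the full three-term inequality.\<close>

lemma tanh_definable_root_term_le:
  assumes q: "0 < q"
  shows "tanh_definable I (\<lambda>y. root_term q a y \<le> root_term q b y + root_term q c y)"
proof -
  obtain \<gamma> \<delta> where a: "a = (\<gamma>, \<delta>)" by fastforce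
  obtain \<gamma>' \<delta>' where b: "b = (\<gamma>', \<delta>')" by fastforce
  obtain \<gamma>'' \<delta>'' where c: "c = (\<gamma>'', \<delta>'')" by fastforce
  \<comment> \<open>The bound 2 holds even if some of the four indices coincide.\<close>
  have box: "basis_fun e + basis_fun e' - (basis_fun g + basis_fun g') \<in> box2 I"
    if "e \<in> I" "e' \<in> I" "g \<in> I" "g' \<in> I" for e e' g g'
    using that by (auto simp: box2_def basis_fun_def)
  note eq = a b c root_term_eq[OF q]
  show ?thesis
  proof (cases "\<gamma> \<in> I \<and> \<delta> \<in> I")
    case False
    then show ?thesis by (auto simp: eq add_nonneg_nonneg tanh_definable_const)
  next
    case A: True
    have two_terms: "tanh_definable I (\<lambda>y. exp (2 * pairing I (basis_fun \<gamma> + basis_fun \<delta>) y)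
        \<le> exp (2 * pairing I (basis_fun e + basis_fun e') y))" if "e \<in> I" "e' \<in> I" for e e'
      using tanh_definable_le_0[OF box[of \<gamma> \<delta> e e']] A that by (simp add: pairing_diff)
    consider (none) "\<not> (\<gamma>' \<in> I \<and> \<delta>' \<in> I)" "\<not> (\<gamma>'' \<in> I \<and> \<delta>'' \<in> I)"
      | (b) "\<gamma>' \<in> I" "\<delta>' \<in> I" "\<not> (\<gamma>'' \<in> I \<and> \<delta>'' \<in> I)"
      | (c) "\<not> (\<gamma>' \<in> I \<and> \<delta>' \<in> I)" "\<gamma>'' \<in> I" "\<delta>'' \<in> I"
      | (both) "\<gamma>' \<in> I" "\<delta>' \<in> I" "\<gamma>'' \<in> I" "\<delta>'' \<in> I" by blast
    then show ?thesis
    proof cases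
      case none
      \<comment> \<open>A positive left side against 0: the condition never holds.\<close>
      then show ?thesis using A tanh_definable_const[of I False] by (simp add: eq not_le[symmetric])
    next
      case b
      then show ?thesis using A two_terms by (cases "\<gamma>'' \<in> I") (simp_all add: eq)
    next
      case c
      then show ?thesis using A two_terms by (cases "\<gamma>' \<in> I") (simp_all add: eq)
    next
      case both
      then show ?thesis
        using A tanh_definable_exp_le[OF box[of \<gamma> \<delta> \<gamma>'' \<delta>''] box[of \<gamma>' \<delta>' \<gamma>'' \<delta>'']]
        by (simp add: eq)
    qed
  qed
qed

lemma tanh_definable_positive_reps:
  assumes q: "0 < q"
  shows "tanh_definable I (\<lambda>y. expmap q y \<in> positive_reps q)"
proof -
  have "tanh_definable I (\<lambda>y. pluecker3 q (ext0 I (expmap q y)) t)" for t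
  proof -
    obtain \<alpha> i j k l where t: "t = (\<alpha>, i, j, k, l)" by (cases t)
    define a where "a = (\<alpha> + unit_vec j + unit_vec k, \<alpha> + unit_vec i + unit_vec l)"
    define b where "b = (\<alpha> + unit_vec i + unit_vec k, \<alpha> + unit_vec j + unit_vec l)"
    define c where "c = (\<alpha> + unit_vec i + unit_vec j, \<alpha> + unit_vec k + unit_vec l)"
    have "pluecker3 q (ext0 I (expmap q y)) t \<longleftrightarrow>
        root_term q a y \<le> root_term q b y + root_term q c y \<and>
        root_term q b y \<le> root_term q a y + root_term q c y \<and>
        root_term q c y \<le> root_term q a y + root_term q b y" for y
      by (simp add: t pluecker3_def Tq_null_def root_term_def a_def b_def c_def)
    then show ?thesis
      by (simp add: tanh_definable_conj tanh_definable_root_term_le[OF q])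
  qed
  then have "tanh_definable I (\<lambda>y. \<forall>t\<in>quads n d \<B>. pluecker3 q (ext0 I (expmap q y)) t)"
    by (intro tanh_definable_all)
  moreover have "expmap q y \<in> I \<rightarrow>\<^sub>E {0<..}" for y by (simp add: expmap_def)
  ultimately show ?thesis by (simp add: positive_reps_def)
qed

lemma Gr_homeomorphic_tanh_system:
  assumes q: "0 < q"
  shows "\<exists>C. (\<forall>s. closed (C s)) \<and>
    Gr_weak_Tq n d \<B> q homeomorphic_space subtopology (powertop_real I) (tanh_system I C)"
proof -
  obtain C where C: "\<forall>s. closed (C s)"
    and iff: "\<And>y. expmap q y \<in> positive_reps q \<and> expmap q y \<in> log_slice n I \<longleftrightarrow> y \<in> tanh_system I C"
    using tanh_definable_conj[OF tanh_definable_positive_reps[OF q] tanh_definable_log_slice[OF q]]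
    unfolding tanh_definable_def by blast
  have "subtopology (weak_rep_space n d \<B> q) (log_slice n I)
      homeomorphic_space subtopology (powertop_real I) (tanh_system I C)"
    by (rule slice_homeomorphic_log[OF q]) (simp add: iff[symmetric])
  then show ?thesis
    using C Gr_homeomorphic_slice homeomorphic_space_trans by blast
qed

end

theorem theorem3p33:
  fixes n d :: nat and \<B> :: "nat set set" and q :: real
  assumes "matroid_by_bases n d \<B>"
    and "0 < q"
  shows "\<exists>(Obj :: nat set) (Arr :: nat set) src tgt ident comp
            (X :: nat \<Rightarrow> (nat \<Rightarrow> real) topology) f.
           finite_top_diagram Obj Arr src tgt ident comp X f \<and>
           (\<forall>i\<in>Obj. is_disc_minus_three_points (X i) \<or> is_ball_minus_petersen (X i)) \<and>
           Gr_weak_Tq n d \<B> q homeomorphic_space diagram_limit Obj Arr src tgt X f"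
proof -
  interpret matroid_by_bases n d \<B> by fact
  obtain C where C: "\<And>s. closed (C s)"
    and Gr: "Gr_weak_Tq n d \<B> q homeomorphic_space
      subtopology (powertop_real (basis_vectors \<B>)) (tanh_system (basis_vectors \<B>) C)"
    using Gr_homeomorphic_tanh_system[OF assms(2)] by blast
  obtain Obj Arr :: "nat set" and src tgt ident comp X f
    where diag: "finite_top_diagram Obj Arr src tgt ident comp X f"
      and objs: "\<forall>i\<in>Obj. X i = top_of_set notched_square"
      and lim: "subtopology (powertop_real (basis_vectors \<B>)) (tanh_system (basis_vectors \<B>) C)
        homeomorphic_space diagram_limit Obj Arr src tgt X f"
    using tanh_system_is_limit[of "basis_vectors \<B>" C, OF finite_basis_vectors C] by blast
  \<comment> \<open>Every object is the notched square, so the disc alternative holds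
    throughout.\<close>
  have "\<forall>i\<in>Obj. is_disc_minus_three_points (X i) \<or> is_ball_minus_petersen (X i)"
    using objs disc_notched_square by simp
  then show ?thesis
    using diag homeomorphic_space_trans[OF Gr lim] by blast
qed

end
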